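(* Let $d\ge 1$, let $T$ be the $d$-regular tree, let $\Gamma \le \mathrm{Aut}(T)$ be a uniform lattice, let $C$ be the commensurator of $\Gamma$ in $\mathrm{Aut}(T)$, let $v$ be a vertex of $T$, and let $C_v = \mathrm{Stab}_C(v)$. Then the edge Kempe switches generate the group $C_v$. That is, $C_v$ is generated by the set of all elements $g(G,u,c,\gamma c) \in C_v$, where $G$ ranges over finite connected $d$-regular graphs, $u$ over the vertices of $G$, $c$ over the proper edge colorings of $G$, and $\gamma$ over the bi-chromatic cycles of $(G,c)$.
   Context: Graphs are undirected and without loops; multiple edges are allowed. A proper edge coloring of a $d$-regular graph $G$ is a map $c : E(G) \to \{1,\ldots,d\}$ such that any two distinct edges sharing a vertex receive different colors. For distinct colors $i,j$, the spanning subgraph of $G$ consisting of all edges of color $i$ or $j$ is, for $G$ finite, a disjoint union of cycles (a cycle of length 2, formed by two parallel edges, is allowed), whose components are the bi-chromatic cycles of $(G,c)$ of type $i,j$. For such a cycle $\gamma$, $\gamma c$ denotes the proper edge coloring obtained from $c$ by exchanging the colors $i$ and $j$ on $\gamma$ and leaving all other edges unchanged (an edge Kempe switch). A uniform lattice in $\mathrm{Aut}(T)$ is a subgroup $\Gamma$ with finite vertex stabilizers and finitely many orbits on the vertices of $T$. Its commensurator is $C=\{g\in \mathrm{Aut}(T) : \Gamma\cap g\Gamma g^{-1}$ has finite index in both $\Gamma$ and $g\Gamma g^{-1}\}$. Identification of elements of $C_v$ with graphs carrying two colorings (a known fact, due to Lubotzky, Mozes and Zimmer, used to interpret the statement): since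 all uniform lattices in $\mathrm{Aut}(T)$ are commensurable up to conjugation, there is a proper edge coloring $\tau : E(T)\to\{1,\ldots,d\}$ such that the group $\Gamma_\tau$ of all $\tau$-preserving automorphisms of $T$ is commensurable with $\Gamma$ (i.e. $\Gamma\cap\Gamma_\tau$ has finite index in both); fix such a $\tau$, so that $C$ is the commensurator of $\Gamma_\tau$. Let $G$ be a finite connected $d$-regular graph with a base vertex $u$ and two proper edge colorings $c_1,c_2$. For $k=1,2$ there is a unique covering map $\pi_k : T\to G$ with $\pi_k(v)=u$ and $c_k\circ\pi_k=\tau$. Then $g(G,u,c_1,c_2)$ denotes the unique automorphism $g$ of $T$ with $g(v)=v$ and $\pi_2\circ g=\pi_1$. It belongs to $C_v$, every element of $C_v$ is of this form, and the description is unique up to passing to finite covers of $G$ (with pulled-back colorings). *)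

theory Defs
  imports "HOL-Algebra.Algebra" "HOL-Combinatorics.Transposition"
begin

section \<open>Undirected multigraphs without loops\<close>

text \<open>
  Every edge is mapped to its two-element set of end vertices; parallel edges are distinct edges
  with the same ends.  Colorings and \<open>ends\<close> are only meaningful on \<open>edges G\<close>.
\<close>

record ('a, 'b) mgraph =
  verts :: "'a set"
  edges :: "'b set"
  ends :: "'b \<Rightarrow> 'a set"

definition mgraph :: "('a, 'b) mgraph \<Rightarrow> bool" where
  "mgraph G \<longleftrightarrow> (\<forall>e\<in>edges G. ends G e \<subseteq> verts G \<and> card (ends G e) = 2)"

definition finite_mgraph :: "('a, 'b) mgraph \<Rightarrow> bool" where
  "finite_mgraph G \<longleftrightarrow> mgraph G \<and> finite (verts G) \<and> finite (edges G)"

definition incident_edges :: "('a, 'b) mgraph \<Rightarrow> 'a \<Rightarrow> 'b set" where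
  "incident_edges G x = {e \<in> edges G. x \<in> ends G e}"

text \<open>
  For \<open>d \<ge> 1\<close> the condition also forces the set of edges at each vertex to be finite.
\<close>

definition regular_mgraph :: "nat \<Rightarrow> ('a, 'b) mgraph \<Rightarrow> bool" where
  "regular_mgraph d G \<longleftrightarrow> (\<forall>x\<in>verts G. card (incident_edges G x) = d)"

definition adjacent :: "('a, 'b) mgraph \<Rightarrow> 'a \<Rightarrow> 'a \<Rightarrow> bool" where
  "adjacent G x y \<longleftrightarrow> (\<exists>e\<in>edges G. ends G e = {x, y})"

definition connected_mgraph :: "('a, 'b) mgraph \<Rightarrow> bool" where
  "connected_mgraph G \<longleftrightarrow>
     verts G \<noteq> {} \<and> (\<forall>x\<in>verts G. \<forall>y\<in>verts G. (adjacent G)\<^sup>*\<^sup>* x y)"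

definition component_at :: "('a, 'b) mgraph \<Rightarrow> 'a \<Rightarrow> ('a, 'b) mgraph" where
  "component_at G x =
     (let V = {y \<in> verts G. (adjacent G)\<^sup>*\<^sup>* x y}
      in \<lparr>verts = V, edges = {e \<in> edges G. ends G e \<subseteq> V}, ends = ends G\<rparr>)"

definition components :: "('a, 'b) mgraph \<Rightarrow> ('a, 'b) mgraph set" where
  "components G = component_at G ` verts G"

text \<open>A cycle may have length 2, consisting of two parallel edges.\<close>

definition is_cycle :: "('a, 'b) mgraph \<Rightarrow> 'a list \<Rightarrow> 'b list \<Rightarrow> bool" where
  "is_cycle G xs es \<longleftrightarrow>
     2 \<le> length xs \<and> length es = length xs \<and> distinct xs \<and> distinct es \<and>
     set xs \<subseteq> verts G \<and> set es \<subseteq> edges G \<and>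
     (\<forall>i<length xs. ends G (es ! i) = {xs ! i, xs ! (Suc i mod length xs)})"

definition tree :: "('a, 'b) mgraph \<Rightarrow> bool" where
  "tree G \<longleftrightarrow> mgraph G \<and> connected_mgraph G \<and> (\<nexists>xs es. is_cycle G xs es)"


section \<open>Edge colorings and Kempe switches\<close>

definition proper_edge_coloring :: "('a, 'b) mgraph \<Rightarrow> nat \<Rightarrow> ('b \<Rightarrow> nat) \<Rightarrow> bool" where
  "proper_edge_coloring G d c \<longleftrightarrow>
     c ` edges G \<subseteq> {1..d} \<and>
     (\<forall>e\<in>edges G. \<forall>f\<in>edges G. e \<noteq> f \<and> ends G e \<inter> ends G f \<noteq> {} \<longrightarrow> c e \<noteq> c f)"

definition bichromatic_cycles ::
    "('a, 'b) mgraph \<Rightarrow> ('b \<Rightarrow> nat) \<Rightarrow> nat \<Rightarrow> nat \<Rightarrow> ('a, 'b) mgraph set" where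
  "bichromatic_cycles G c i j = components (G\<lparr>edges := {e \<in> edges G. c e = i \<or> c e = j}\<rparr>)"

definition kempe_switch ::
    "nat \<Rightarrow> nat \<Rightarrow> ('a, 'b) mgraph \<Rightarrow> ('b \<Rightarrow> nat) \<Rightarrow> 'b \<Rightarrow> nat" where
  "kempe_switch i j \<gamma> c = (\<lambda>e. if e \<in> edges \<gamma> then Transposition.transpose i j (c e) else c e)"


section \<open>Coverings and automorphisms\<close>

text \<open>
  Because of parallel edges a graph map is a pair of a vertex map and an edge map, both
  extensional so that equality of maps is equality of the underlying HOL functions.
\<close>

type_synonym ('a, 'b, 'c, 'd) gmap = "('a \<Rightarrow> 'c) \<times> ('b \<Rightarrow> 'd)"

definition graph_hom ::
    "('a, 'b) mgraph \<Rightarrow> ('c, 'd) mgraph \<Rightarrow> ('a, 'b, 'c, 'd) gmap set" where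
  "graph_hom G H =
     {p. fst p \<in> verts G \<rightarrow>\<^sub>E verts H \<and> snd p \<in> edges G \<rightarrow>\<^sub>E edges H \<and>
         (\<forall>e\<in>edges G. ends H (snd p e) = fst p ` ends G e)}"

definition covering_maps ::
    "('a, 'b) mgraph \<Rightarrow> ('c, 'd) mgraph \<Rightarrow> ('a, 'b, 'c, 'd) gmap set" where
  "covering_maps G H =
     {p \<in> graph_hom G H. fst p ` verts G = verts H \<and>
         (\<forall>x\<in>verts G. bij_betw (snd p) (incident_edges G x) (incident_edges H (fst p x)))}"

text \<open>
  An automorphism is a pair of compatible permutations of the vertices and of the edges.  In a
  tree the edge permutation is determined by the vertex permutation.
\<close>

definition aut_group :: "('a, 'b) mgraph \<Rightarrow> ('a, 'b, 'a, 'b) gmap monoid" where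
  "aut_group G =
     (BijGroup (verts G) \<times>\<times> BijGroup (edges G))
       \<lparr>carrier := {g \<in> Bij (verts G) \<times> Bij (edges G).
                     \<forall>e\<in>edges G. ends G (snd g e) = fst g ` ends G e}\<rparr>"

text \<open>The action on vertices is \<open>fst\<close>, in the argument order of the group actions of the library.\<close>

definition uniform_lattice :: "('a, 'b) mgraph \<Rightarrow> ('a, 'b, 'a, 'b) gmap set \<Rightarrow> bool" where
  "uniform_lattice T \<Gamma> \<longleftrightarrow>
     subgroup \<Gamma> (aut_group T) \<and>
     (\<forall>x\<in>verts T. finite (stabilizer ((aut_group T)\<lparr>carrier := \<Gamma>\<rparr>) fst x)) \<and>
     finite (orbits ((aut_group T)\<lparr>carrier := \<Gamma>\<rparr>) (verts T) fst)"

definition color_preserving ::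
    "('a, 'b) mgraph \<Rightarrow> ('b \<Rightarrow> nat) \<Rightarrow> ('a, 'b, 'a, 'b) gmap set" where
  "color_preserving T \<tau> = {g \<in> carrier (aut_group T). \<forall>e\<in>edges T. \<tau> (snd g e) = \<tau> e}"


section \<open>Commensurators\<close>

text \<open>\<open>K\<close> has finite index in \<open>H\<close>; both are subgroups of \<open>A\<close>.\<close>

definition finite_index_in :: "('g, 'm) monoid_scheme \<Rightarrow> 'g set \<Rightarrow> 'g set \<Rightarrow> bool" where
  "finite_index_in A K H \<longleftrightarrow> finite (rcosets\<^bsub>A\<lparr>carrier := H\<rparr>\<^esub> K)"

definition commensurable :: "('g, 'm) monoid_scheme \<Rightarrow> 'g set \<Rightarrow> 'g set \<Rightarrow> bool" where
  "commensurable A H K \<longleftrightarrow> finite_index_in A (H \<inter> K) H \<and> finite_index_in A (H \<inter> K) K"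

definition commensurator :: "('g, 'm) monoid_scheme \<Rightarrow> 'g set \<Rightarrow> 'g set" where
  "commensurator A H =
     {g \<in> carrier A. commensurable A H (g <#\<^bsub>A\<^esub> H #>\<^bsub>A\<^esub> inv\<^bsub>A\<^esub> g)}"


section \<open>Automorphisms of the tree from pairs of colorings\<close>

text \<open>The covering \<open>T \<rightarrow> G\<close> that maps \<open>v\<close> to \<open>u\<close> and pulls \<open>c\<close> back to \<open>\<tau>\<close>.\<close>

definition colored_covering ::
    "('a, 'b) mgraph \<Rightarrow> ('b \<Rightarrow> nat) \<Rightarrow> 'a \<Rightarrow> ('c, 'd) mgraph \<Rightarrow> 'c \<Rightarrow> ('d \<Rightarrow> nat) \<Rightarrow>
     ('a, 'b, 'c, 'd) gmap" where
  "colored_covering T \<tau> v G u c =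
     (THE p. p \<in> covering_maps T G \<and> fst p v = u \<and> (\<forall>e\<in>edges T. c (snd p e) = \<tau> e))"

definition recoloring_aut ::
    "('a, 'b) mgraph \<Rightarrow> ('b \<Rightarrow> nat) \<Rightarrow> 'a \<Rightarrow> ('c, 'd) mgraph \<Rightarrow> 'c \<Rightarrow> ('d \<Rightarrow> nat) \<Rightarrow> ('d \<Rightarrow> nat) \<Rightarrow>
     ('a, 'b, 'a, 'b) gmap" where
  "recoloring_aut T \<tau> v G u c\<^sub>1 c\<^sub>2 =
     (let \<pi>\<^sub>1 = colored_covering T \<tau> v G u c\<^sub>1; \<pi>\<^sub>2 = colored_covering T \<tau> v G u c\<^sub>2
      in THE g. g \<in> carrier (aut_group T) \<and> fst g v = v \<and>
           (\<forall>x\<in>verts T. fst \<pi>\<^sub>2 (fst g x) = fst \<pi>\<^sub>1 x) \<and>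
           (\<forall>e\<in>edges T. snd \<pi>\<^sub>2 (snd g e) = snd \<pi>\<^sub>1 e))"

text \<open>
  The finite graphs \<open>G\<close> are taken with vertices and edges in \<open>nat\<close>: every finite graph is
  isomorphic to such a graph, and an isomorphism carrying along the base vertex and the two
  colorings does not change \<open>recoloring_aut\<close>.
\<close>

definition edge_kempe_switches ::
    "('a, 'b) mgraph \<Rightarrow> nat \<Rightarrow> ('b \<Rightarrow> nat) \<Rightarrow> 'a \<Rightarrow> ('a, 'b, 'a, 'b) gmap set" where
  "edge_kempe_switches T d \<tau> v =
     {recoloring_aut T \<tau> v G u c (kempe_switch i j \<gamma> c) | (G :: (nat, nat) mgraph) u c i j \<gamma>.
        finite_mgraph G \<and> connected_mgraph G \<and> regular_mgraph d G \<and> u \<in> verts G \<and>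
        proper_edge_coloring G d c \<and> i \<in> {1..d} \<and> j \<in> {1..d} \<and> i \<noteq> j \<and>
        \<gamma> \<in> bichromatic_cycles G c i j}"

end

theory Submission
  imports Defs "HOL-Library.Nat_Bijection"
begin

text \<open>
  Describe an automorphism \<open>g\<close> of the tree by its portrait, the permutation of the colors that it
  induces at each vertex.  Since the tree is simply connected, an automorphism fixing the base
  vertex is the same as a family of permutations in which the two ends of every edge agree on the
  color of that edge (\<open>aut_eqI\<close>, \<open>aut_exists\<close>).  It commensurates the color-preserving group exactly
  if its portrait is periodic, that is, factors through a finite colored quotient of the tree
  (\<open>commensurator_color_preserving_if_periodic\<close>, \<open>commensurator_color_preserving_periodic\<close>).  The
  automorphism of a finite graph with two colorings has the portrait that sends the first color of
  an edge to the second one (\<open>recoloring_aut_portrait\<close>), so it is of this kind; in particular the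
  Kempe switches lie in the stabilizer.

  For the converse, call a set of vertices of the tree periodic if it is a union of fibres of such
  a quotient.  Composing the portrait of an element of the group generated by the Kempe switches
  with a transposition \<open>(i j)\<close> on a periodic set that is closed under the chains of colors \<open>i, j\<close>
  of the current coloring gives an element of this group again (\<open>kempe_generated_switch\<close>), because
  in a finite quotient such a set is a disjoint union of bichromatic cycles.

  It remains to reach every periodic portrait by such moves.  This is done one color class at a
  time (\<open>kempe_step\<close>).  Let \<open>g\<close> fix all colors above \<open>k\<close>, and let \<open>M\<close> be the perfect matching of
  the edges whose image has color \<open>k\<close>.  If all edges of \<open>M\<close> on an infinite path alternating
  between \<open>M\<close> and color \<open>k\<close> had the same color \<open>a\<close>, then the path would be a chain of colors
  \<open>a, k\<close>, and switching it would move color \<open>k\<close> to \<open>M\<close>.  To arrange this for all these paths at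
  once, pass to a cover whose sheets are indexed by the permutations of the colors below \<open>k\<close>.
  Edges of colors other than \<open>k\<close> stay in their sheet.  An edge of color \<open>k\<close> whose ends meet edges
  of \<open>M\<close> of colors \<open>j\<close> and \<open>j'\<close> leads from sheet \<open>\<rho>\<close> to sheet \<open>\<rho> \<circ> (j j')\<close>.  Now permute the
  colors below \<open>k\<close> in each sheet \<open>\<rho>\<close> by \<open>\<rho>\<close> itself.  No edge of color \<open>k\<close> is involved, so this is a
  sequence of Kempe switches (\<open>kempe_generated_sheets\<close>), and after it the color \<open>\<rho> j\<close> of the edge
  of \<open>M\<close> does not change across an edge of color \<open>k\<close>, because \<open>(\<rho> \<circ> (j j')) j' = \<rho> j\<close>.
\<close>

section \<open>Properly colored regular graphs\<close>

lemma connected_mgraph_induct: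
  assumes conn: "connected_mgraph G" and u: "u \<in> verts G" and x: "x \<in> verts G"
    and base: "P u"
    and step: "\<And>x y. x \<in> verts G \<Longrightarrow> y \<in> verts G \<Longrightarrow> P x \<Longrightarrow> adjacent G x y \<Longrightarrow> P y"
    and mg: "mgraph G"
  shows "P x"
proof -
  have in_verts: "z \<in> verts G" if "adjacent G y z" for y z
    using that mg by (auto simp: adjacent_def mgraph_def)
  have "(adjacent G)\<^sup>*\<^sup>* u x"
    using conn u x by (simp add: connected_mgraph_def)
  then have "x \<in> verts G \<and> P x"
    by (induction rule: rtranclp_induct) (use u base step in_verts in blast)+
  then show ?thesis ..
qed

locale colored_graph =
  fixes G :: "('a, 'b) mgraph" and d :: nat and c :: "'b \<Rightarrow> nat"
  assumes mgraph: "mgraph G"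
    and regular: "regular_mgraph d G"
    and proper: "proper_edge_coloring G d c"
    and degree_pos: "1 \<le> d"
begin

definition edge_at :: "'a \<Rightarrow> nat \<Rightarrow> 'b" where
  "edge_at x i = the_inv_into (incident_edges G x) c i"

definition nbr :: "'a \<Rightarrow> nat \<Rightarrow> 'a" where
  "nbr x i = the_elem (ends G (edge_at x i) - {x})"

lemma coloring_bij_betw:
  assumes "x \<in> verts G"
  shows "bij_betw c (incident_edges G x) {1..d}"
proof -
  have card: "card (incident_edges G x) = d"
    using regular assms by (simp add: regular_mgraph_def)
  have inj: "inj_on c (incident_edges G x)"
    using proper unfolding proper_edge_coloring_def incident_edges_def inj_on_def by blast
  have sub: "c ` incident_edges G x \<subseteq> {1..d}"
    using proper unfolding proper_edge_coloring_def incident_edges_def by blast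
  have "c ` incident_edges G x = {1..d}"
    by (rule card_subset_eq) (use card inj sub in \<open>auto simp: card_image\<close>)
  with inj show ?thesis by (simp add: bij_betw_def)
qed

lemma edge_at:
  assumes "x \<in> verts G" "i \<in> {1..d}"
  shows "edge_at x i \<in> edges G" "c (edge_at x i) = i" "x \<in> ends G (edge_at x i)"
proof -
  note bij = coloring_bij_betw[OF assms(1)]
  have "edge_at x i \<in> incident_edges G x"
    unfolding edge_at_def using bij assms(2)
    by (metis bij_betw_def the_inv_into_into subset_refl)
  then show "edge_at x i \<in> edges G" "x \<in> ends G (edge_at x i)"
    by (auto simp: incident_edges_def)
  show "c (edge_at x i) = i"
    unfolding edge_at_def using bij assms(2) by (simp add: bij_betw_def f_the_inv_into_f)
qed

lemma ends_in_verts: "e \<in> edges G \<Longrightarrow> x \<in> ends G e \<Longrightarrow> x \<in> verts G"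
  using mgraph by (auto simp: mgraph_def)

lemma color_in_range: "e \<in> edges G \<Longrightarrow> c e \<in> {1..d}"
  using proper by (auto simp: proper_edge_coloring_def)

lemma edge_eq_edge_at:
  assumes "e \<in> edges G" "x \<in> ends G e"
  shows "e = edge_at x (c e)"
proof -
  have "inj_on c (incident_edges G x)"
    using coloring_bij_betw ends_in_verts assms by (auto simp: bij_betw_def)
  then show ?thesis
    unfolding edge_at_def using assms by (simp add: the_inv_into_f_f incident_edges_def)
qed

lemma ends_edge_at:
  assumes "x \<in> verts G" "i \<in> {1..d}"
  shows "ends G (edge_at x i) = {x, nbr x i}" "nbr x i \<noteq> x"
proof -
  have "card (ends G (edge_at x i)) = 2"
    using mgraph edge_at[OF assms] by (auto simp: mgraph_def)
  with edge_at(3)[OF assms] obtain y where "ends G (edge_at x i) = {x, y}" "y \<noteq> x"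
    by (metis card_2_iff doubleton_eq_iff insert_iff singletonD)
  then show "ends G (edge_at x i) = {x, nbr x i}" "nbr x i \<noteq> x"
    unfolding nbr_def by (simp_all add: insert_Diff_if)
qed

lemma nbr_in_verts [simp, intro]:
  assumes "x \<in> verts G" "i \<in> {1..d}"
  shows "nbr x i \<in> verts G"
  using ends_in_verts[OF edge_at(1)[OF assms]] ends_edge_at(1)[OF assms] by simp

lemma edge_at_nbr:
  assumes "x \<in> verts G" "i \<in> {1..d}"
  shows "edge_at (nbr x i) i = edge_at x i"
  using edge_eq_edge_at[OF edge_at(1)[OF assms], of "nbr x i"] ends_edge_at(1)[OF assms]
    edge_at(2)[OF assms] by simp

lemma nbr_nbr [simp]:
  assumes "x \<in> verts G" "i \<in> {1..d}"
  shows "nbr (nbr x i) i = x"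
proof -
  have "{nbr x i, nbr (nbr x i) i} = {x, nbr x i}"
    using ends_edge_at(1)[OF nbr_in_verts[OF assms] assms(2)] ends_edge_at(1)[OF assms]
      edge_at_nbr[OF assms] by simp
  then show ?thesis
    using ends_edge_at(2)[OF nbr_in_verts[OF assms] assms(2)] by (metis doubleton_eq_iff)
qed

lemma edge_cases:
  assumes "e \<in> edges G"
  obtains x where "x \<in> verts G" "c e \<in> {1..d}" "e = edge_at x (c e)"
proof -
  have "card (ends G e) = 2"
    using mgraph assms by (simp add: mgraph_def)
  then obtain x where "x \<in> ends G e" by fastforce
  then show ?thesis
    using that assms edge_eq_edge_at ends_in_verts color_in_range by blast
qed

lemma adjacent_iff_nbr:
  assumes "x \<in> verts G"
  shows "adjacent G x y \<longleftrightarrow> (\<exists>i\<in>{1..d}. y = nbr x i)"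
proof
  assume "adjacent G x y"
  then obtain e where e: "e \<in> edges G" "ends G e = {x, y}" by (auto simp: adjacent_def)
  have "card (ends G e) = 2"
    using mgraph e(1) by (simp add: mgraph_def)
  then have "x \<noteq> y" using e by auto
  moreover have "e = edge_at x (c e)" using edge_eq_edge_at e by auto
  ultimately have "y = nbr x (c e)"
    using ends_edge_at[OF assms color_in_range[OF e(1)]] e by (metis doubleton_eq_iff)
  then show "\<exists>i\<in>{1..d}. y = nbr x i"
    using color_in_range[OF e(1)] by blast
next
  assume "\<exists>i\<in>{1..d}. y = nbr x i"
  then show "adjacent G x y"
    unfolding adjacent_def using edge_at(1) ends_edge_at(1) assms by blast
qed

lemma nbr_induct [consumes 3, case_names base step]:
  assumes "connected_mgraph G" "u \<in> verts G" "x \<in> verts G"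
    and "P u"
    and "\<And>x i. x \<in> verts G \<Longrightarrow> i \<in> {1..d} \<Longrightarrow> P x \<Longrightarrow> P (nbr x i)"
  shows "P x"
  by (rule connected_mgraph_induct[of G u]) (use assms adjacent_iff_nbr mgraph in auto)

lemma walk_in_verts:
  "x \<in> verts G \<Longrightarrow> w \<in> lists {1..d} \<Longrightarrow> foldl nbr x w \<in> verts G"
  by (induction w arbitrary: x) auto

lemma walk_exists:
  assumes "connected_mgraph G" "u \<in> verts G" "x \<in> verts G"
  shows "\<exists>w\<in>lists {1..d}. foldl nbr u w = x"
  using assms
proof (induction rule: nbr_induct)
  case base
  show ?case by (rule bexI[of _ "[]"]) auto
next
  case (step x i)
  then obtain w where "w \<in> lists {1..d}" "foldl nbr u w = x" by blast
  then show ?case using step by (intro bexI[of _ "w @ [i]"]) auto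
qed

text \<open>
  A shortest nonempty closed walk without backtracking does not revisit a vertex, so it is a cycle;
  if it has length 2, its two edges are distinct because consecutive colors differ.
\<close>

lemma acyclic_no_reduced_closed_walk:
  assumes acyclic: "\<nexists>xs es. is_cycle G xs es"
    and "x \<in> verts G" "w \<in> lists {1..d}" "w \<noteq> []" "distinct_adj w"
  shows "foldl nbr x w \<noteq> x"
  using assms(2-)
proof (induction "length w" arbitrary: x w rule: less_induct)
  case less
  show ?case
  proof
    assume closed: "foldl nbr x w = x"
    define n where "n = length w"
    define p where "p k = foldl nbr x (take k w)" for k
    have letter: "w ! k \<in> {1..d}" if "k < n" for k
      using less.prems that nth_mem unfolding n_def by blast
    have take_lists: "take k w \<in> lists {1..d}" "drop k w \<in> lists {1..d}" for k
      using less.prems(2) by (metis append_in_lists_conv append_take_drop_id)+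
    have p_verts: "p k \<in> verts G" for k
      unfolding p_def using walk_in_verts less.prems take_lists by blast
    have p_Suc: "p (Suc k) = nbr (p k) (w ! k)" if "k < n" for k
      unfolding p_def using that by (simp add: take_Suc_conv_app_nth n_def)
    have p_n: "p n = x" and p_0: "p 0 = x"
      using closed by (simp_all add: p_def n_def)
    have p_inj: "p a \<noteq> p b" if "a < b" "b < n" for a b
    proof
      assume eq: "p a = p b"
      define u where "u = take (b - a) (drop a w)"
      have split: "take b w = take a w @ u"
        unfolding u_def using that by (metis le_add_diff_inverse less_imp_le take_add)
      have "foldl nbr (p a) u = p a"
        using split eq unfolding p_def by (metis foldl_append)
      moreover have "distinct_adj u"
        unfolding u_def using less.prems(4) by (metis append_take_drop_id distinct_adj_append_iff)
      moreover have "u \<in> lists {1..d}"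
        using split take_lists by (metis append_in_lists_conv)
      moreover have "length u < length w" "u \<noteq> []"
        using that unfolding u_def n_def by auto
      ultimately show False
        using less.hyps p_verts by blast
    qed
    have n_ge: "2 \<le> n"
    proof -
      have "n \<noteq> 0" using less.prems by (simp add: n_def)
      moreover have "n \<noteq> 1"
        using p_Suc[of 0] p_0 p_n ends_edge_at(2)[OF less.prems(1), of "w ! 0"] letter[of 0] by auto
      ultimately show ?thesis by linarith
    qed
    define xs where "xs = map p [0..<n]"
    define es where "es = map (\<lambda>k. edge_at (p k) (w ! k)) [0..<n]"
    have "is_cycle G xs es"
      unfolding is_cycle_def
    proof (intro conjI)
      show "2 \<le> length xs" "length es = length xs"
        using n_ge by (simp_all add: xs_def es_def)
      show "distinct xs"
        unfolding xs_def distinct_map inj_on_def using p_inj by (auto) (metis nat_neq_iff)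
      have es_inj: "edge_at (p a) (w ! a) \<noteq> edge_at (p b) (w ! b)" if "a < b" "b < n" for a b
      proof
        assume eq: "edge_at (p a) (w ! a) = edge_at (p b) (w ! b)"
        have la: "w ! a \<in> {1..d}" and lb: "w ! b \<in> {1..d}" using letter that by auto
        have col: "w ! a = w ! b"
          using eq edge_at(2)[OF p_verts la] edge_at(2)[OF p_verts lb] by metis
        have "{p a, p (Suc a)} = {p b, p (Suc b)}"
          using arg_cong[OF eq, of "ends G"] ends_edge_at(1)[OF p_verts[of a] la]
            ends_edge_at(1)[OF p_verts[of b] lb] p_Suc[of a] p_Suc[of b] that by simp
        then have "p (Suc a) = p b"
          using p_inj[OF that] by (metis doubleton_eq_iff)
        then have "Suc a = b"
          using p_inj[of "Suc a" b] that by (metis Suc_lessI)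
        then show False
          using col distinct_adj_nth[OF less.prems(4)] that n_def by auto
      qed
      show "distinct es"
        unfolding es_def distinct_map inj_on_def using es_inj by (auto) (metis nat_neq_iff)
      show "set xs \<subseteq> verts G"
        using p_verts by (auto simp: xs_def)
      show "set es \<subseteq> edges G"
        using edge_at(1)[OF p_verts letter] by (auto simp: es_def)
      have "p (Suc k mod n) = p (Suc k)" if "k < n" for k
        using that p_0 p_n by (cases "Suc k = n") auto
      then show "\<forall>i<length xs. ends G (es ! i) = {xs ! i, xs ! (Suc i mod length xs)}"
        using ends_edge_at(1)[OF p_verts letter] p_Suc n_ge by (auto simp: xs_def es_def)
    qed
    with acyclic show False by blast
  qed
qed

end

lemma not_distinct_adjE:
  assumes "\<not> distinct_adj w"
  obtains us i vs where "w = us @ [i, i] @ vs"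
proof -
  from assms obtain k where k: "Suc k < length w" "w ! k = w ! Suc k"
    by (auto simp: distinct_adj_conv_nth)
  then have "w = take k w @ [w ! k, w ! k] @ drop (Suc (Suc k)) w"
    by (metis Cons_nth_drop_Suc Suc_lessD append_Cons append_Nil append_take_drop_id)
  with that show ?thesis by blast
qed

locale colored_tree = colored_graph T d \<tau>
  for T :: "('a, 'b) mgraph" and d :: nat and \<tau> :: "'b \<Rightarrow> nat" +
  fixes v :: 'a
  assumes tree: "tree T" and base_vertex [simp]: "v \<in> verts T"
begin

lemma connected: "connected_mgraph T"
  using tree by (simp add: tree_def)

lemmas tree_induct [consumes 2, case_names base step] = nbr_induct[OF connected]

text \<open>
  The next two lemmas say that the tree is simply connected.  A closed walk backtracks somewhere,
  and deleting the backtracking changes neither its end nor its effect under involutions.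
\<close>

lemma closed_walk_acts_trivially:
  assumes act: "\<And>u i. u \<in> S \<Longrightarrow> i \<in> {1..d} \<Longrightarrow> act u i \<in> S \<and> act (act u i) i = u"
    and "x \<in> verts T" "w \<in> lists {1..d}" "foldl nbr x w = x" "u \<in> S"
  shows "foldl act u w = u"
  using assms(3,4)
proof (induction "length w" arbitrary: w rule: less_induct)
  case less
  show ?case
  proof (cases "w = []")
    case False
    have "\<not> distinct_adj w"
      using acyclic_no_reduced_closed_walk[OF _ assms(2) less.prems(1) False] less.prems(2) tree
      by (auto simp: tree_def)
    then obtain us i vs where w: "w = us @ [i, i] @ vs" by (rule not_distinct_adjE)
    with less.prems have us: "us \<in> lists {1..d}" and i: "i \<in> {1..d}" and vs: "vs \<in> lists {1..d}"
      by auto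
    have S: "foldl act u us \<in> S"
      using us \<open>u \<in> S\<close> act by (induction us arbitrary: u) auto
    have "foldl nbr x us \<in> verts T"
      using us assms(2) by (intro walk_in_verts)
    then have "foldl nbr x (us @ vs) = x"
      using less.prems(2) i unfolding w by simp
    with less.hyps[of "us @ vs"] us vs have "foldl act u (us @ vs) = u"
      by (simp add: w)
    then show ?thesis
      using act[OF S i] unfolding w by simp
  qed simp
qed

lemma equivariant_map_exists:
  assumes act: "\<And>u i. u \<in> S \<Longrightarrow> i \<in> {1..d} \<Longrightarrow> act u i \<in> S \<and> act (act u i) i = u"
    and y: "y \<in> verts T" and u: "u \<in> S"
  obtains f where "f y = u" "\<And>x. x \<in> verts T \<Longrightarrow> f x \<in> S"
    "\<And>x i. x \<in> verts T \<Longrightarrow> i \<in> {1..d} \<Longrightarrow> f (nbr x i) = act (f x) i"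
proof -
  have act_X: "foldl act u w \<in> S" if "w \<in> lists {1..d}" for w
    using that u act by (induction w arbitrary: u) auto
  have rev_nbr: "foldl nbr (foldl nbr x w) (rev w) = x" if "w \<in> lists {1..d}" "x \<in> verts T" for w x
    using that by (induction w arbitrary: x) auto
  have rev_act: "foldl act (foldl act u w) (rev w) = u" if "w \<in> lists {1..d}" "u \<in> S" for w u
    using that act by (induction w arbitrary: u) auto
  have indep: "foldl act u w = foldl act u w'"
    if "w \<in> lists {1..d}" "w' \<in> lists {1..d}" "foldl nbr y w = foldl nbr y w'" for w w'
  proof -
    have rev: "rev w' \<in> lists {1..d}" using that(2) by (simp add: in_lists_conv_set)
    have "foldl nbr y (w @ rev w') = y"
      using that rev_nbr y by simp
    then have "foldl act u (w @ rev w') = u"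
      using rev that(1) u by (intro closed_walk_acts_trivially[of S act, OF act y]) auto
    then have "foldl act (foldl act (foldl act u w) (rev w')) w' = foldl act u w'" by simp
    moreover have "foldl act (foldl act (foldl act u w) (rev w')) (rev (rev w')) = foldl act u w"
      using rev_act[OF rev act_X[OF that(1)]] .
    ultimately show ?thesis by simp
  qed
  define word where "word x = (SOME w. w \<in> lists {1..d} \<and> foldl nbr y w = x)" for x
  have word: "word x \<in> lists {1..d}" "foldl nbr y (word x) = x" if "x \<in> verts T" for x
    using someI_ex[of "\<lambda>w. w \<in> lists {1..d} \<and> foldl nbr y w = x"]
      walk_exists[OF connected y that] unfolding word_def by auto
  show thesis
  proof (rule that[of "\<lambda>x. foldl act u (word x)"])
    show "foldl act u (word y) = u"
      using indep[of "word y" "[]"] word y by simp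
    show "foldl act u (word x) \<in> S" if "x \<in> verts T" for x
      using act_X word that by blast
    show "foldl act u (word (nbr x i)) = act (foldl act u (word x)) i"
      if "x \<in> verts T" "i \<in> {1..d}" for x i
      using indep[of "word (nbr x i)" "word x @ [i]"] word[OF that(1)] word[of "nbr x i"] that
      by simp
  qed
qed

end

section \<open>Automorphisms of a tree and their portraits\<close>

lemma carrier_aut_group:
  "carrier (aut_group G) = {g \<in> Bij (verts G) \<times> Bij (edges G).
     \<forall>e\<in>edges G. ends G (snd g e) = fst g ` ends G e}"
  by (simp add: aut_group_def)

lemma aut_fst_bij: "g \<in> carrier (aut_group G) \<Longrightarrow> bij_betw (fst g) (verts G) (verts G)"
  and aut_snd_bij: "g \<in> carrier (aut_group G) \<Longrightarrow> bij_betw (snd g) (edges G) (edges G)"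
  and aut_fst_extensional: "g \<in> carrier (aut_group G) \<Longrightarrow> fst g \<in> extensional (verts G)"
  and aut_snd_extensional: "g \<in> carrier (aut_group G) \<Longrightarrow> snd g \<in> extensional (edges G)"
  and aut_ends: "g \<in> carrier (aut_group G) \<Longrightarrow> e \<in> edges G \<Longrightarrow> ends G (snd g e) = fst g ` ends G e"
  by (auto simp: carrier_aut_group Bij_def)

lemma aut_fst_in [simp, intro]: "g \<in> carrier (aut_group G) \<Longrightarrow> x \<in> verts G \<Longrightarrow> fst g x \<in> verts G"
  using aut_fst_bij bij_betwE by blast

lemma aut_snd_in [simp, intro]: "g \<in> carrier (aut_group G) \<Longrightarrow> e \<in> edges G \<Longrightarrow> snd g e \<in> edges G"
  using aut_snd_bij bij_betwE by blast

lemma mult_aut_group: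
  assumes "g \<in> carrier (aut_group G)" "h \<in> carrier (aut_group G)"
  shows "g \<otimes>\<^bsub>aut_group G\<^esub> h = (compose (verts G) (fst g) (fst h), compose (edges G) (snd g) (snd h))"
  using assms by (cases g; cases h) (simp add: aut_group_def BijGroup_def DirProd_def)

lemma one_aut_group: "\<one>\<^bsub>aut_group G\<^esub> = (\<lambda>x\<in>verts G. x, \<lambda>e\<in>edges G. e)"
  by (simp add: aut_group_def BijGroup_def DirProd_def)

lemma group_aut_group:
  assumes "mgraph G"
  shows "group (aut_group G)"
proof -
  let ?B = "BijGroup (verts G) \<times>\<times> BijGroup (edges G)"
  let ?S = "carrier (aut_group G)"
  interpret B: group ?B
    by (intro DirProd_group group_BijGroup)
  have carrier_Bij: "carrier (BijGroup S) = Bij S" for S :: "'c set"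
    by (simp add: BijGroup_def)
  have carrier_B: "carrier ?B = Bij (verts G) \<times> Bij (edges G)"
    by (simp add: BijGroup_def)
  have ends_verts: "ends G e \<subseteq> verts G" if "e \<in> edges G" for e
    using assms that by (auto simp: mgraph_def)
  have "subgroup ?S ?B"
  proof (rule B.subgroupI)
    show "?S \<subseteq> carrier ?B"
      unfolding carrier_B by (auto simp: carrier_aut_group)
    have "(\<lambda>x\<in>verts G. x, \<lambda>e\<in>edges G. e) \<in> ?S"
      using ends_verts by (auto simp: carrier_aut_group id_Bij image_iff)
    then show "?S \<noteq> {}" by blast
  next
    fix g assume g: "g \<in> ?S"
    then have bij: "fst g \<in> Bij (verts G)" "snd g \<in> Bij (edges G)"
      by (auto simp: carrier_aut_group)
    have inv: "inv\<^bsub>?B\<^esub> g = (\<lambda>x\<in>verts G. inv_into (verts G) (fst g) x,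
        \<lambda>e\<in>edges G. inv_into (edges G) (snd g) e)"
      using bij inv_DirProd[OF group_BijGroup group_BijGroup, of "fst g" "verts G" "snd g" "edges G"]
      by (simp add: inv_BijGroup carrier_Bij)
    have "ends G (inv_into (edges G) (snd g) e) = (\<lambda>x\<in>verts G. inv_into (verts G) (fst g) x) ` ends G e"
      if e: "e \<in> edges G" for e
    proof -
      let ?e = "inv_into (edges G) (snd g) e"
      have e': "?e \<in> edges G" "snd g ?e = e"
        using e aut_snd_bij[OF g] by (auto simp: bij_betw_def inv_into_into f_inv_into_f)
      have "(\<lambda>x\<in>verts G. inv_into (verts G) (fst g) x) ` ends G e
          = (\<lambda>x\<in>verts G. inv_into (verts G) (fst g) x) ` fst g ` ends G ?e"
        using aut_ends[OF g e'(1)] e'(2) by simp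
      also have "\<dots> = (\<lambda>x. x) ` ends G ?e"
        unfolding image_image
        by (rule image_cong[OF refl])
          (use ends_verts[OF e'(1)] g aut_fst_bij[OF g] in \<open>auto simp: bij_betw_def\<close>)
      finally show ?thesis by simp
    qed
    then show "inv\<^bsub>?B\<^esub> g \<in> ?S"
      unfolding inv using bij by (auto simp: carrier_aut_group restrict_inv_into_Bij)
  next
    fix g h assume g: "g \<in> ?S" and h: "h \<in> ?S"
    then have "g \<otimes>\<^bsub>?B\<^esub> h = (compose (verts G) (fst g) (fst h), compose (edges G) (snd g) (snd h))"
      by (simp add: mult_DirProd' BijGroup_def carrier_aut_group mem_Times_iff)
    moreover have "ends G (compose (edges G) (snd g) (snd h) e)
        = compose (verts G) (fst g) (fst h) ` ends G e" if e: "e \<in> edges G" for e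
    proof -
      have "ends G (compose (edges G) (snd g) (snd h) e) = (\<lambda>x. fst g (fst h x)) ` ends G e"
        using e aut_ends[OF g aut_snd_in[OF h e]] aut_ends[OF h e]
        by (simp add: compose_def image_image)
      also have "\<dots> = compose (verts G) (fst g) (fst h) ` ends G e"
        by (rule image_cong[OF refl]) (use ends_verts[OF e] in \<open>auto simp: compose_def\<close>)
      finally show ?thesis .
    qed
    ultimately show "g \<otimes>\<^bsub>?B\<^esub> h \<in> ?S"
      using g h by (auto simp: carrier_aut_group compose_Bij)
  qed
  moreover have "?B\<lparr>carrier := ?S\<rparr> = aut_group G"
    by (simp add: aut_group_def)
  ultimately show ?thesis
    using B.subgroup_imp_group by metis
qed

context colored_tree
begin

abbreviation "A \<equiv> aut_group T"

sublocale A: group "aut_group T"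
  using group_aut_group mgraph .

lemma fst_mult:
  "g \<in> carrier A \<Longrightarrow> h \<in> carrier A \<Longrightarrow> x \<in> verts T \<Longrightarrow> fst (g \<otimes>\<^bsub>A\<^esub> h) x = fst g (fst h x)"
  and snd_mult:
  "g \<in> carrier A \<Longrightarrow> h \<in> carrier A \<Longrightarrow> e \<in> edges T \<Longrightarrow> snd (g \<otimes>\<^bsub>A\<^esub> h) e = snd g (snd h e)"
  by (simp_all add: mult_aut_group compose_def)

lemma fst_one: "x \<in> verts T \<Longrightarrow> fst \<one>\<^bsub>A\<^esub> x = x"
  and snd_one: "e \<in> edges T \<Longrightarrow> snd \<one>\<^bsub>A\<^esub> e = e"
  by (simp_all add: one_aut_group)

lemma fst_inv_fst: "g \<in> carrier A \<Longrightarrow> x \<in> verts T \<Longrightarrow> fst (inv\<^bsub>A\<^esub> g) (fst g x) = x"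
  by (metis A.inv_closed A.l_inv fst_mult fst_one)

lemma fst_fst_inv: "g \<in> carrier A \<Longrightarrow> x \<in> verts T \<Longrightarrow> fst g (fst (inv\<^bsub>A\<^esub> g) x) = x"
  by (metis A.inv_closed A.r_inv fst_mult fst_one)

definition portrait :: "('a \<Rightarrow> 'a) \<times> ('b \<Rightarrow> 'b) \<Rightarrow> 'a \<Rightarrow> nat \<Rightarrow> nat" where
  "portrait g x i = (if i \<in> {1..d} then \<tau> (snd g (edge_at x i)) else i)"

lemma snd_edge_at:
  assumes "g \<in> carrier A" "x \<in> verts T" "i \<in> {1..d}"
  shows "snd g (edge_at x i) = edge_at (fst g x) (portrait g x i)"
proof -
  have "fst g x \<in> ends T (snd g (edge_at x i))"
    using aut_ends[OF assms(1) edge_at(1)[OF assms(2,3)]] edge_at(3)[OF assms(2,3)] by simp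
  then show ?thesis
    using edge_eq_edge_at[of "snd g (edge_at x i)" "fst g x"] assms edge_at
    by (simp add: portrait_def)
qed

lemma portrait_in_range:
  assumes "g \<in> carrier A" "x \<in> verts T" "i \<in> {1..d}"
  shows "portrait g x i \<in> {1..d}"
  using assms color_in_range[of "snd g (edge_at x i)"] edge_at by (simp add: portrait_def)

lemma fst_nbr:
  assumes "g \<in> carrier A" "x \<in> verts T" "i \<in> {1..d}"
  shows "fst g (nbr x i) = nbr (fst g x) (portrait g x i)"
proof -
  have "{fst g x, fst g (nbr x i)} = {fst g x, nbr (fst g x) (portrait g x i)}"
    using aut_ends[OF assms(1) edge_at(1)[OF assms(2,3)]] ends_edge_at(1)[OF assms(2,3)]
      snd_edge_at[OF assms] ends_edge_at(1)[of "fst g x" "portrait g x i"]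
      portrait_in_range[OF assms] assms by simp
  moreover have "fst g x \<noteq> fst g (nbr x i)"
    using aut_fst_bij[OF assms(1)] ends_edge_at(2)[OF assms(2,3)] assms
    by (metis bij_betw_inv_into_left nbr_in_verts)
  ultimately show ?thesis by (metis doubleton_eq_iff)
qed

lemma portrait_nbr:
  assumes "x \<in> verts T" "i \<in> {1..d}"
  shows "portrait g (nbr x i) i = portrait g x i"
  using assms by (simp add: portrait_def edge_at_nbr)

lemma portrait_one: "x \<in> verts T \<Longrightarrow> portrait \<one>\<^bsub>A\<^esub> x = id"
  by (auto simp: portrait_def snd_one edge_at)

lemma portrait_mult:
  assumes "g \<in> carrier A" "h \<in> carrier A" "x \<in> verts T"
  shows "portrait (g \<otimes>\<^bsub>A\<^esub> h) x = portrait g (fst h x) \<circ> portrait h x"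
proof
  fix i
  show "portrait (g \<otimes>\<^bsub>A\<^esub> h) x i = (portrait g (fst h x) \<circ> portrait h x) i"
  proof (cases "i \<in> {1..d}")
    case True
    have "snd (g \<otimes>\<^bsub>A\<^esub> h) (edge_at x i) = snd g (edge_at (fst h x) (portrait h x i))"
      using snd_mult[OF assms(1,2) edge_at(1)[OF assms(3) True]] snd_edge_at[OF assms(2,3) True]
      by simp
    then show ?thesis
      using True portrait_in_range[OF assms(2,3) True] by (simp add: portrait_def)
  qed (auto simp: portrait_def)
qed

lemma portrait_permutes:
  assumes "g \<in> carrier A" "x \<in> verts T"
  shows "portrait g x permutes {1..d}"
proof (rule bij_imp_permutes)
  have "inv\<^bsub>A\<^esub> g \<otimes>\<^bsub>A\<^esub> g = \<one>\<^bsub>A\<^esub>" using assms by simp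
  then have "portrait (inv\<^bsub>A\<^esub> g) (fst g x) \<circ> portrait g x = id"
    using portrait_mult[of "inv\<^bsub>A\<^esub> g" g x] portrait_one assms by simp
  then have "inj_on (portrait g x) {1..d}"
    by (metis inj_on_id inj_on_imageI2)
  moreover have "portrait g x ` {1..d} \<subseteq> {1..d}"
    using portrait_in_range[OF assms] by blast
  ultimately show "bij_betw (portrait g x) {1..d} {1..d}"
    by (simp add: bij_betw_def endo_inj_surj)
qed (auto simp: portrait_def)

lemma portrait_inv:
  assumes "g \<in> carrier A" "x \<in> verts T"
  shows "portrait (inv\<^bsub>A\<^esub> g) (fst g x) = inv_into UNIV (portrait g x)"
proof -
  have "inv\<^bsub>A\<^esub> g \<otimes>\<^bsub>A\<^esub> g = \<one>\<^bsub>A\<^esub>" using assms by simp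
  then have "portrait (inv\<^bsub>A\<^esub> g) (fst g x) \<circ> portrait g x = id"
    using portrait_mult[of "inv\<^bsub>A\<^esub> g" g x] portrait_one assms by simp
  then show ?thesis
    using portrait_permutes[OF assms] by (metis inv_unique_comp permutes_inv_o(1) o_assoc comp_id id_comp)
qed

lemma aut_eqI:
  assumes g: "g \<in> carrier A" and h: "h \<in> carrier A"
    and y: "y \<in> verts T" "fst g y = fst h y"
    and portraits: "\<And>x i. x \<in> verts T \<Longrightarrow> i \<in> {1..d} \<Longrightarrow> portrait g x i = portrait h x i"
  shows "g = h"
proof -
  have fst: "fst g x = fst h x" if "x \<in> verts T" for x
    using y(1) that
  proof (induction rule: tree_induct)
    case (step x i)
    then show ?case using portraits g h by (simp add: fst_nbr)
  qed (use y in simp)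
  have "snd g e = snd h e" if "e \<in> edges T" for e
    using that by (rule edge_cases) (use fst portraits g h snd_edge_at in metis)
  with fst show ?thesis
    using aut_fst_extensional[OF g] aut_fst_extensional[OF h]
      aut_snd_extensional[OF g] aut_snd_extensional[OF h]
    by (intro prod_eqI extensionalityI[of _ "verts T"] extensionalityI[of _ "edges T"]) auto
qed

definition is_portrait :: "('a \<Rightarrow> nat \<Rightarrow> nat) \<Rightarrow> bool" where
  "is_portrait \<sigma> \<longleftrightarrow> (\<forall>x\<in>verts T. \<sigma> x permutes {1..d} \<and> (\<forall>i\<in>{1..d}. \<sigma> (nbr x i) i = \<sigma> x i))"

lemma is_portrait_portrait: "g \<in> carrier A \<Longrightarrow> is_portrait (portrait g)"
  using portrait_permutes portrait_nbr unfolding is_portrait_def by blast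

lemma is_portraitD:
  assumes "is_portrait \<sigma>" "x \<in> verts T"
  shows "\<sigma> x permutes {1..d}" "i \<in> {1..d} \<Longrightarrow> \<sigma> (nbr x i) i = \<sigma> x i"
    "i \<in> {1..d} \<Longrightarrow> \<sigma> x i \<in> {1..d}" "i \<in> {1..d} \<Longrightarrow> inv_into UNIV (\<sigma> x) i \<in> {1..d}"
    "\<sigma> x (inv_into UNIV (\<sigma> x) i) = i" "inv_into UNIV (\<sigma> x) (\<sigma> x i) = i"
proof -
  show p: "\<sigma> x permutes {1..d}" using assms by (simp add: is_portrait_def)
  show "i \<in> {1..d} \<Longrightarrow> \<sigma> (nbr x i) i = \<sigma> x i" using assms by (simp add: is_portrait_def)
  show "i \<in> {1..d} \<Longrightarrow> \<sigma> x i \<in> {1..d}" "i \<in> {1..d} \<Longrightarrow> inv_into UNIV (\<sigma> x) i \<in> {1..d}"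
    using p permutes_in_image permutes_inv by metis+
  show "\<sigma> x (inv_into UNIV (\<sigma> x) i) = i" "inv_into UNIV (\<sigma> x) (\<sigma> x i) = i"
    using permutes_inverses[OF p] by simp_all
qed

text \<open>
  Both the vertex map and its inverse are equivariant maps into pairs of vertices.  The pair keeps
  track of the vertex in the source, on which the permutation of the colors depends.
\<close>

lemma aut_exists:
  assumes \<sigma>: "is_portrait \<sigma>" and y: "y \<in> verts T" and z: "z \<in> verts T"
  obtains g where "g \<in> carrier A" "fst g y = z"
    "\<And>x i. x \<in> verts T \<Longrightarrow> i \<in> {1..d} \<Longrightarrow> portrait g x i = \<sigma> x i"
proof -
  note \<sigma>D = is_portraitD[OF \<sigma>]
  let ?V = "verts T"
  obtain f where f: "f y = (y, z)" "\<And>x. x \<in> ?V \<Longrightarrow> f x \<in> ?V \<times> ?V"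
    "\<And>x i. x \<in> ?V \<Longrightarrow> i \<in> {1..d} \<Longrightarrow> f (nbr x i) = (nbr (fst (f x)) i, nbr (snd (f x)) (\<sigma> (fst (f x)) i))"
    by (rule equivariant_map_exists[of "?V \<times> ?V" "\<lambda>p i. (nbr (fst p) i, nbr (snd p) (\<sigma> (fst p) i))" y "(y, z)"])
      (use y z \<sigma>D in auto)
  obtain f' where f': "f' z = (z, y)" "\<And>x. x \<in> ?V \<Longrightarrow> f' x \<in> ?V \<times> ?V"
    "\<And>x i. x \<in> ?V \<Longrightarrow> i \<in> {1..d} \<Longrightarrow>
        f' (nbr x i) = (nbr (fst (f' x)) i, nbr (snd (f' x)) (inv_into UNIV (\<sigma> (snd (f' x))) i))"
  proof (rule equivariant_map_exists[of "?V \<times> ?V"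
          "\<lambda>p i. (nbr (fst p) i, nbr (snd p) (inv_into UNIV (\<sigma> (snd p)) i))" z "(z, y)"])
    fix p i assume p: "p \<in> ?V \<times> ?V" and i: "i \<in> {1..d}"
    then obtain x' x where p': "p = (x', x)" "x' \<in> ?V" "x \<in> ?V" by auto
    let ?j = "inv_into UNIV (\<sigma> x) i"
    have j: "?j \<in> {1..d}" using \<sigma>D(4) p' i by blast
    have "\<sigma> (nbr x ?j) ?j = i"
      using \<sigma>D(2)[OF p'(3) j] \<sigma>D(5)[OF p'(3)] by simp
    then have "inv_into UNIV (\<sigma> (nbr x ?j)) i = ?j"
      using \<sigma>D(6)[of "nbr x ?j" ?j] p' j by auto
    then show "(nbr (fst p) i, nbr (snd p) (inv_into UNIV (\<sigma> (snd p)) i)) \<in> ?V \<times> ?V \<and>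
        (nbr (fst (nbr (fst p) i, nbr (snd p) (inv_into UNIV (\<sigma> (snd p)) i))) i,
         nbr (snd (nbr (fst p) i, nbr (snd p) (inv_into UNIV (\<sigma> (snd p)) i)))
           (inv_into UNIV (\<sigma> (snd (nbr (fst p) i, nbr (snd p) (inv_into UNIV (\<sigma> (snd p)) i)))) i)) = p"
      using p' i j by auto
  qed (use y z in auto)
  define g where "g x = snd (f x)" for x
  define h where "h x = snd (f' x)" for x
  have f_fst: "fst (f x) = x" if "x \<in> ?V" for x
    using y that by (induction rule: tree_induct) (simp_all add: f)
  have f'_fst: "fst (f' x) = x" if "x \<in> ?V" for x
    using z that by (induction rule: tree_induct) (simp_all add: f')
  have g: "g y = z" "\<And>x. x \<in> ?V \<Longrightarrow> g x \<in> ?V"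
    "\<And>x i. x \<in> ?V \<Longrightarrow> i \<in> {1..d} \<Longrightarrow> g (nbr x i) = nbr (g x) (\<sigma> x i)"
    using f f_fst by (auto simp: g_def mem_Times_iff)
  have h: "h z = y" "\<And>x. x \<in> ?V \<Longrightarrow> h x \<in> ?V"
    "\<And>x i. x \<in> ?V \<Longrightarrow> i \<in> {1..d} \<Longrightarrow> h (nbr x i) = nbr (h x) (inv_into UNIV (\<sigma> (h x)) i)"
    using f' f'_fst by (auto simp: h_def mem_Times_iff)
  have hg: "h (g x) = x" if "x \<in> ?V" for x
    using y that
  proof (induction rule: tree_induct)
    case (step x i)
    then have "h (g (nbr x i)) = nbr x (inv_into UNIV (\<sigma> x) (\<sigma> x i))"
      using g(2) h(3)[of "g x" "\<sigma> x i"] \<sigma>D(3) g(3) by simp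
    then show ?case using \<sigma>D(6) step by simp
  qed (simp add: g h)
  have gh: "g (h x) = x" if "x \<in> ?V" for x
    using z that
  proof (induction rule: tree_induct)
    case (step x i)
    then have "g (h (nbr x i)) = nbr x (\<sigma> (h x) (inv_into UNIV (\<sigma> (h x)) i))"
      using h(2,3) g(3)[of "h x" "inv_into UNIV (\<sigma> (h x)) i"] \<sigma>D(4) by simp
    then show ?case using \<sigma>D(5) step h by simp
  qed (simp add: g h)
  have g_bij: "bij_betw g ?V ?V"
    by (rule bij_betw_byWitness[where f' = h]) (use hg gh g h in auto)
  \<comment> \<open>The edge map; by the compatibility of \<open>\<sigma>\<close> it does not matter which end of \<open>e\<close> is chosen.\<close>
  define k where "k e = (let x = SOME x. x \<in> ends T e in edge_at (g x) (\<sigma> x (\<tau> e)))" for e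
  have k: "k (edge_at x i) = edge_at (g x) (\<sigma> x i)" if x: "x \<in> ?V" and i: "i \<in> {1..d}" for x i
  proof -
    define x' where "x' = (SOME x'. x' \<in> ends T (edge_at x i))"
    have "x' \<in> ends T (edge_at x i)"
      unfolding x'_def using edge_at(3)[OF that] by (rule someI)
    then have "x' = x \<or> x' = nbr x i"
      using ends_edge_at(1)[OF that] by simp
    then have "edge_at (g x') (\<sigma> x' i) = edge_at (g x) (\<sigma> x i)"
      using that g edge_at_nbr[of "g x" "\<sigma> x i"] \<sigma>D(2,3)[OF x] by auto
    then show ?thesis
      using edge_at(2)[OF that] unfolding k_def x'_def Let_def by simp
  qed
  have k_bij: "bij_betw k (edges T) (edges T)"
  proof (rule bij_betw_imageI)
    show "inj_on k (edges T)"
    proof (rule inj_onI)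
      fix e e' assume e: "e \<in> edges T" and e': "e' \<in> edges T" and eq: "k e = k e'"
      from e obtain x i where x: "x \<in> ?V" "i \<in> {1..d}" "e = edge_at x i" by (rule edge_cases)
      from e' obtain x' i' where x': "x' \<in> ?V" "i' \<in> {1..d}" "e' = edge_at x' i'" by (rule edge_cases)
      have m: "\<sigma> x i = \<sigma> x' i'"
        using eq k x x' edge_at(2) g(2) \<sigma>D(3) by metis
      have "{g x, g (nbr x i)} = {g x', g (nbr x' i')}"
        using arg_cong[OF eq, of "ends T"] k x x' ends_edge_at(1) g(2,3) \<sigma>D(3) by simp
      then have "g x' = g x \<or> g x' = g (nbr x i)" by blast
      then have "x' = x \<or> x' = nbr x i"
        using hg x x' by (metis nbr_in_verts)
      then show "e = e'"
      proof
        assume "x' = x"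
        then show ?thesis using m \<sigma>D(6) x x' by metis
      next
        assume *: "x' = nbr x i"
        then have "i' = i" using m \<sigma>D(2)[OF x(1,2)] \<sigma>D(6)[OF x'(1)] by metis
        then show ?thesis using * edge_at_nbr x x' by simp
      qed
    qed
    show "k ` edges T = edges T"
    proof (intro equalityI subsetI)
      fix e assume "e \<in> k ` edges T"
      then obtain e' where e': "e' \<in> edges T" "e = k e'" by blast
      from e'(1) obtain x i where x: "x \<in> ?V" "i \<in> {1..d}" "e' = edge_at x i" by (rule edge_cases)
      then show "e \<in> edges T"
        using k[OF x(1,2)] edge_at(1)[OF g(2)[OF x(1)] \<sigma>D(3)[OF x(1,2)]] e'(2) by simp
    next
      fix e assume "e \<in> edges T"
      then obtain x i where x: "x \<in> ?V" "i \<in> {1..d}" "e = edge_at x i" by (rule edge_cases)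
      let ?e = "edge_at (h x) (inv_into UNIV (\<sigma> (h x)) i)"
      have "k ?e = e"
        using x k h(2) \<sigma>D(4,5) gh by simp
      then show "e \<in> k ` edges T"
        using edge_at(1) h(2) \<sigma>D(4) x by (metis imageI)
    qed
  qed
  let ?g = "(restrict g ?V, restrict k (edges T))"
  have carrier: "?g \<in> carrier A"
  proof -
    have "bij_betw (restrict g ?V) ?V ?V" "bij_betw (restrict k (edges T)) (edges T) (edges T)"
      using g_bij k_bij by (simp_all cong: bij_betw_cong)
    moreover have "ends T (k e) = restrict g ?V ` ends T e" if "e \<in> edges T" for e
      using that
    proof (rule edge_cases)
      fix x assume x: "x \<in> ?V" "\<tau> e \<in> {1..d}" "e = edge_at x (\<tau> e)"
      define i where "i = \<tau> e"
      have x: "x \<in> ?V" "i \<in> {1..d}" "e = edge_at x i" using x by (simp_all add: i_def)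
      then show ?thesis
        using k[OF x(1,2)] ends_edge_at(1) g \<sigma>D(3) by simp
    qed
    ultimately show ?thesis
      by (auto simp: carrier_aut_group Bij_def)
  qed
  show thesis
  proof (rule that[OF carrier])
    show "fst ?g y = z" using y g by simp
    show "portrait ?g x i = \<sigma> x i" if "x \<in> ?V" "i \<in> {1..d}" for x i
      using that k edge_at g(2) \<sigma>D(3) by (simp add: portrait_def)
  qed
qed

end

section \<open>Commensurable subgroups\<close>

context group
begin

text \<open>
  Unlike the index of an intersection, this relation is visibly transitive and compatible with
  conjugation; between subgroups it means that their intersection has finite index in the first.
\<close>

definition covered_by_cosets :: "'a set \<Rightarrow> 'a set \<Rightarrow> bool" where
  "covered_by_cosets H K \<longleftrightarrow> (\<exists>R. finite R \<and> R \<subseteq> carrier G \<and> H \<subseteq> (\<Union>r\<in>R. K #> r))"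

definition conj_set :: "'a \<Rightarrow> 'a set \<Rightarrow> 'a set" where
  "conj_set g H = g <# H #> inv g"

lemma conj_set_eq_image: "conj_set g H = (\<lambda>h. g \<otimes> h \<otimes> inv g) ` H"
  by (auto simp: conj_set_def l_coset_def r_coset_def)

lemma mem_conj_set: "x \<in> conj_set g H \<longleftrightarrow> (\<exists>h\<in>H. x = g \<otimes> h \<otimes> inv g)"
  by (auto simp: conj_set_eq_image)

lemma finite_index_iff_covered:
  assumes H: "subgroup H G" and K: "subgroup K G"
  shows "finite_index_in G (H \<inter> K) H \<longleftrightarrow> covered_by_cosets H K"
proof -
  let ?f = "\<lambda>h. (H \<inter> K) #> h"
  have HK: "subgroup (H \<inter> K) G"
    using H K by (rule subgroups_Inter_pair)
  have H_carrier: "h \<in> carrier G" if "h \<in> H" for h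
    using subgroup.mem_carrier[OF H that] .
  have "rcosets\<^bsub>G\<lparr>carrier := H\<rparr>\<^esub> (H \<inter> K) = ?f ` H"
    by (auto simp: RCOSETS_def r_coset_def)
  then have index: "finite_index_in G (H \<inter> K) H \<longleftrightarrow> finite (?f ` H)"
    by (simp add: finite_index_in_def)
  show ?thesis
  proof
    assume "finite_index_in G (H \<inter> K) H"
    then obtain R where R: "R \<subseteq> H" "finite R" "?f ` H = ?f ` R"
      using index finite_subset_image[of "?f ` H" ?f H] by auto
    have "H \<subseteq> (\<Union>r\<in>R. K #> r)"
    proof
      fix h assume h: "h \<in> H"
      then obtain r where r: "r \<in> R" "?f h = ?f r" using R(3) by (metis imageE imageI)
      have "h \<in> ?f h"
        using rcos_self[OF H_carrier[OF h] HK] .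
      then have "h \<in> K #> r" unfolding r(2) by (auto simp: r_coset_def)
      with r(1) show "h \<in> (\<Union>r\<in>R. K #> r)" by blast
    qed
    then show "covered_by_cosets H K"
      unfolding covered_by_cosets_def using R(1,2) H_carrier by (intro exI[of _ R]) auto
  next
    assume "covered_by_cosets H K"
    then obtain R where R: "finite R" "R \<subseteq> carrier G" "H \<subseteq> (\<Union>r\<in>R. K #> r)"
      by (auto simp: covered_by_cosets_def)
    define s where "s r = (SOME h. h \<in> H \<and> h \<in> K #> r)" for r
    have "?f ` H \<subseteq> (\<lambda>r. ?f (s r)) ` R"
    proof (intro subsetI, elim imageE)
      fix Y h assume Y: "Y = ?f h" and h: "h \<in> H"
      then obtain r where r: "r \<in> R" "h \<in> K #> r" using R(3) by blast
      have s: "s r \<in> H" "s r \<in> K #> r"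
        using someI_ex[of "\<lambda>h. h \<in> H \<and> h \<in> K #> r"] h r unfolding s_def by blast+
      obtain k k' where k: "k \<in> K" "h = k \<otimes> r" "k' \<in> K" "s r = k' \<otimes> r"
        using r(2) s(2) by (auto simp: r_coset_def)
      have carr: "k \<in> carrier G" "k' \<in> carrier G" "r \<in> carrier G"
        using k r R(2) subgroup.mem_carrier[OF K] by auto
      have "s r \<otimes> inv h = k' \<otimes> inv k"
        using carr k by (simp add: inv_mult_group m_assoc) (metis inv_closed inv_solve_left m_closed)
      then have "s r \<otimes> inv h \<in> H \<inter> K"
        using s(1) h k H K by (metis IntI subgroup.m_closed subgroup.m_inv_closed)
      moreover have "s r = s r \<otimes> inv h \<otimes> h"
        using s(1) h H_carrier by (simp add: m_assoc)
      ultimately have "s r \<in> ?f h"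
        unfolding r_coset_def by blast
      then have "?f h = ?f (s r)"
        using repr_independence[OF _ H_carrier[OF h] HK] by blast
      then show "Y \<in> (\<lambda>r. ?f (s r)) ` R" using Y r(1) by blast
    qed
    then show "finite_index_in G (H \<inter> K) H"
      using index R(1) finite_surj by blast
  qed
qed

lemma covered_by_cosets_trans:
  assumes "covered_by_cosets H K" "covered_by_cosets K L" "L \<subseteq> carrier G"
  shows "covered_by_cosets H L"
proof -
  obtain R where R: "finite R" "R \<subseteq> carrier G" "H \<subseteq> (\<Union>r\<in>R. K #> r)"
    using assms by (auto simp: covered_by_cosets_def)
  obtain S where S: "finite S" "S \<subseteq> carrier G" "K \<subseteq> (\<Union>s\<in>S. L #> s)"
    using assms by (auto simp: covered_by_cosets_def)
  have "H \<subseteq> (\<Union>t\<in>(\<lambda>(s, r). s \<otimes> r) ` (S \<times> R). L #> t)"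
  proof
    fix h assume "h \<in> H"
    then obtain r k where r: "r \<in> R" "k \<in> K" "h = k \<otimes> r"
      using R(3) by (auto simp: r_coset_def)
    then obtain s l where s: "s \<in> S" "l \<in> L" "k = l \<otimes> s"
      using S(3) by (auto simp: r_coset_def)
    have "h = l \<otimes> (s \<otimes> r)"
      using r s R(2) S(2) assms(3) by (auto simp: m_assoc subset_iff)
    then show "h \<in> (\<Union>t\<in>(\<lambda>(s, r). s \<otimes> r) ` (S \<times> R). L #> t)"
      using r s by (auto simp: r_coset_def)
  qed
  moreover have "finite ((\<lambda>(s, r). s \<otimes> r) ` (S \<times> R))"
    using R S by simp
  moreover have "(\<lambda>(s, r). s \<otimes> r) ` (S \<times> R) \<subseteq> carrier G"
    using R S by auto
  ultimately show ?thesis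
    unfolding covered_by_cosets_def by (intro exI conjI)
qed

lemma covered_by_cosets_conj:
  assumes "covered_by_cosets H K" "g \<in> carrier G" "K \<subseteq> carrier G"
  shows "covered_by_cosets (conj_set g H) (conj_set g K)"
proof -
  obtain R where R: "finite R" "R \<subseteq> carrier G" "H \<subseteq> (\<Union>r\<in>R. K #> r)"
    using assms by (auto simp: covered_by_cosets_def)
  have "conj_set g H \<subseteq> (\<Union>r\<in>(\<lambda>r. g \<otimes> r \<otimes> inv g) ` R. conj_set g K #> r)"
  proof
    fix x assume "x \<in> conj_set g H"
    then obtain h where h: "h \<in> H" "x = g \<otimes> h \<otimes> inv g" by (auto simp: mem_conj_set)
    then obtain r k where r: "r \<in> R" "k \<in> K" "h = k \<otimes> r"
      using R(3) by (auto simp: r_coset_def)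
    have carr: "r \<in> carrier G" "k \<in> carrier G" using r R(2) assms(3) by auto
    have "x = (g \<otimes> k \<otimes> inv g) \<otimes> (g \<otimes> r \<otimes> inv g)"
    proof -
      have "inv g \<otimes> (g \<otimes> (r \<otimes> inv g)) = r \<otimes> inv g"
        using carr assms(2) by (simp add: m_assoc[symmetric])
      then show ?thesis
        unfolding h(2) r(3) using carr assms(2) by (simp add: m_assoc)
    qed
    then show "x \<in> (\<Union>r\<in>(\<lambda>r. g \<otimes> r \<otimes> inv g) ` R. conj_set g K #> r)"
      using r mem_conj_set unfolding r_coset_def by blast
  qed
  then show ?thesis
    unfolding covered_by_cosets_def using R assms(2)
    by (intro exI[of _ "(\<lambda>r. g \<otimes> r \<otimes> inv g) ` R"]) auto
qed

lemma conj_set_mult: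
  assumes "g \<in> carrier G" "h \<in> carrier G" "H \<subseteq> carrier G"
  shows "conj_set (g \<otimes> h) H = conj_set g (conj_set h H)"
proof -
  have "(g \<otimes> h) \<otimes> x \<otimes> inv (g \<otimes> h) = g \<otimes> (h \<otimes> x \<otimes> inv h) \<otimes> inv g" if "x \<in> H" for x
    using assms that by (auto simp: inv_mult_group m_assoc subset_iff)
  then show ?thesis
    by (simp add: conj_set_eq_image image_image cong: image_cong)
qed

lemma conj_set_one: "H \<subseteq> carrier G \<Longrightarrow> conj_set \<one> H = H"
  by (simp add: conj_set_eq_image subset_iff cong: image_cong)

lemma subgroup_conj_set:
  assumes H: "subgroup H G" and g: "g \<in> carrier G"
  shows "subgroup (conj_set g H) G"
  using subgroup_conjugation_is_surj1[OF inv_closed[OF g] H] g by (simp add: conj_set_def)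

lemma commensurable_iff_covered:
  assumes "subgroup H G" "subgroup K G"
  shows "commensurable G H K \<longleftrightarrow> covered_by_cosets H K \<and> covered_by_cosets K H"
  using finite_index_iff_covered[OF assms] finite_index_iff_covered[OF assms(2,1)]
  by (simp add: commensurable_def Int_commute)

lemma commensurable_sym: "commensurable G H K \<Longrightarrow> commensurable G K H"
  by (auto simp: commensurable_def Int_commute)

lemma commensurable_trans:
  assumes "subgroup H G" "subgroup K G" "subgroup L G" "commensurable G H K" "commensurable G K L"
  shows "commensurable G H L"
  using assms by (meson commensurable_iff_covered covered_by_cosets_trans subgroup.subset)

lemma commensurable_conj:
  assumes "subgroup H G" "subgroup K G" "g \<in> carrier G" "commensurable G H K"
  shows "commensurable G (conj_set g H) (conj_set g K)"
  using assms by (meson commensurable_iff_covered covered_by_cosets_conj subgroup.subset subgroup_conj_set)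

lemma mem_commensurator:
  "g \<in> commensurator G H \<longleftrightarrow> g \<in> carrier G \<and> commensurable G H (conj_set g H)"
  by (simp add: commensurator_def conj_set_def)

lemma commensurator_cong:
  assumes H: "subgroup H G" and K: "subgroup K G" and HK: "commensurable G H K"
  shows "commensurator G H = commensurator G K"
proof -
  have "g \<in> commensurator G K"
    if H: "subgroup H G" and K: "subgroup K G" and HK: "commensurable G H K"
      and g: "g \<in> commensurator G H" for H K g
  proof -
    have g: "g \<in> carrier G" "commensurable G H (conj_set g H)"
      using g by (simp_all add: mem_commensurator)
    note sub = H K subgroup_conj_set[OF H g(1)] subgroup_conj_set[OF K g(1)]
    have "commensurable G K (conj_set g H)"
      using commensurable_trans[OF sub(2,1,3) commensurable_sym[OF HK] g(2)] .
    then have "commensurable G K (conj_set g K)"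
      using commensurable_trans[OF sub(2,3,4)] commensurable_conj[OF H K g(1) HK] by blast
    then show ?thesis using g(1) by (simp add: mem_commensurator)
  qed
  then show ?thesis
    using assms commensurable_sym by blast
qed

lemma subgroup_commensurator:
  assumes H: "subgroup H G"
  shows "subgroup (commensurator G H) G"
proof (rule subgroupI)
  note HG = subgroup.subset[OF H]
  show "commensurator G H \<subseteq> carrier G" by (auto simp: mem_commensurator)
  have "commensurable G H H"
    unfolding commensurable_iff_covered[OF H H] covered_by_cosets_def
    using coset_mult_one[OF HG] by (intro conjI exI[of _ "{\<one>}"]) auto
  then have "\<one> \<in> commensurator G H"
    using conj_set_one[OF HG] by (simp add: mem_commensurator)
  then show "commensurator G H \<noteq> {}" by blast
  show "inv g \<in> commensurator G H" if "g \<in> commensurator G H" for g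
  proof -
    have g: "g \<in> carrier G" "commensurable G H (conj_set g H)"
      using that by (simp_all add: mem_commensurator)
    have "commensurable G (conj_set (inv g) H) (conj_set (inv g) (conj_set g H))"
      using commensurable_conj[OF H subgroup_conj_set[OF H g(1)] inv_closed[OF g(1)] g(2)] .
    moreover have "conj_set (inv g) (conj_set g H) = H"
      using conj_set_mult[OF inv_closed[OF g(1)] g(1) HG] conj_set_one[OF HG] g(1) by simp
    ultimately show ?thesis
      using commensurable_sym g(1) by (simp add: mem_commensurator)
  qed
  show "g \<otimes> h \<in> commensurator G H" if "g \<in> commensurator G H" "h \<in> commensurator G H" for g h
  proof -
    have g: "g \<in> carrier G" "commensurable G H (conj_set g H)"
      and h: "h \<in> carrier G" "commensurable G H (conj_set h H)"
      using that by (simp_all add: mem_commensurator)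
    note sub = H subgroup_conj_set[OF H g(1)] subgroup_conj_set[OF H h(1)]
    have "commensurable G (conj_set g H) (conj_set g (conj_set h H))"
      using commensurable_conj[OF H sub(3) g(1) h(2)] .
    then have "commensurable G H (conj_set (g \<otimes> h) H)"
      using commensurable_trans[OF H sub(2) subgroup_conj_set[OF sub(3) g(1)] g(2)]
      by (simp add: conj_set_mult[OF g(1) h(1) HG])
    then show ?thesis using g(1) h(1) by (simp add: mem_commensurator)
  qed
qed

end

section \<open>The commensurator consists of the automorphisms with periodic portrait\<close>

context colored_tree
begin

text \<open>
  A map with these properties is the same as an equivariant map onto a finite set with involutions
  indexed by the colors, without a choice of names for its elements.
\<close>

definition periodic :: "('a \<Rightarrow> 'q) \<Rightarrow> bool" where
  "periodic q \<longleftrightarrow> finite (q ` verts T) \<and>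
     (\<forall>x\<in>verts T. \<forall>y\<in>verts T. \<forall>i\<in>{1..d}. q x = q y \<longrightarrow> q (nbr x i) = q (nbr y i))"

definition depends_on :: "('a \<Rightarrow> 'q) \<Rightarrow> ('a \<Rightarrow> 'r) \<Rightarrow> bool" where
  "depends_on q f \<longleftrightarrow> (\<forall>x\<in>verts T. \<forall>y\<in>verts T. q x = q y \<longrightarrow> f x = f y)"

lemma periodic_nbr:
  "periodic q \<Longrightarrow> x \<in> verts T \<Longrightarrow> y \<in> verts T \<Longrightarrow> i \<in> {1..d} \<Longrightarrow> q x = q y \<Longrightarrow> q (nbr x i) = q (nbr y i)"
  unfolding periodic_def by blast

lemma depends_onD: "depends_on q f \<Longrightarrow> x \<in> verts T \<Longrightarrow> y \<in> verts T \<Longrightarrow> q x = q y \<Longrightarrow> f x = f y"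
  unfolding depends_on_def by blast

abbreviation "\<Gamma>\<^sub>\<tau> \<equiv> color_preserving T \<tau>"

lemma color_preserving_iff:
  "g \<in> \<Gamma>\<^sub>\<tau> \<longleftrightarrow> g \<in> carrier A \<and> (\<forall>x\<in>verts T. portrait g x = id)"
proof -
  have "(\<forall>e\<in>edges T. \<tau> (snd g e) = \<tau> e) \<longleftrightarrow> (\<forall>x\<in>verts T. portrait g x = id)"
  proof
    assume "\<forall>e\<in>edges T. \<tau> (snd g e) = \<tau> e"
    then show "\<forall>x\<in>verts T. portrait g x = id"
      using edge_at by (auto simp: portrait_def fun_eq_iff)
  next
    assume id: "\<forall>x\<in>verts T. portrait g x = id"
    show "\<forall>e\<in>edges T. \<tau> (snd g e) = \<tau> e"
    proof
      fix e assume "e \<in> edges T"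
      then obtain x where "x \<in> verts T" "\<tau> e \<in> {1..d}" "e = edge_at x (\<tau> e)" by (rule edge_cases)
      then show "\<tau> (snd g e) = \<tau> e"
        using id unfolding portrait_def fun_eq_iff by (metis id_apply)
    qed
  qed
  then show ?thesis by (auto simp: color_preserving_def)
qed

lemma color_preserving_carrier: "g \<in> \<Gamma>\<^sub>\<tau> \<Longrightarrow> g \<in> carrier A"
  and color_preserving_portrait: "g \<in> \<Gamma>\<^sub>\<tau> \<Longrightarrow> x \<in> verts T \<Longrightarrow> portrait g x = id"
  by (auto simp: color_preserving_iff)

lemma fst_nbr_color_preserving:
  "g \<in> \<Gamma>\<^sub>\<tau> \<Longrightarrow> x \<in> verts T \<Longrightarrow> i \<in> {1..d} \<Longrightarrow> fst g (nbr x i) = nbr (fst g x) i"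
  by (simp add: color_preserving_iff fst_nbr)

lemma portrait_inv_at:
  assumes "g \<in> carrier A" "y \<in> verts T"
  shows "portrait (inv\<^bsub>A\<^esub> g) y = inv_into UNIV (portrait g (fst (inv\<^bsub>A\<^esub> g) y))"
  using portrait_inv[OF assms(1), of "fst (inv\<^bsub>A\<^esub> g) y"] assms by (simp add: fst_fst_inv)

lemma subgroup_color_preserving: "subgroup \<Gamma>\<^sub>\<tau> A"
proof (rule A.subgroupI)
  show "\<Gamma>\<^sub>\<tau> \<subseteq> carrier A" using color_preserving_carrier by blast
  have "\<one>\<^bsub>A\<^esub> \<in> \<Gamma>\<^sub>\<tau>" by (simp add: color_preserving_iff portrait_one)
  then show "\<Gamma>\<^sub>\<tau> \<noteq> {}" by blast
  show "inv\<^bsub>A\<^esub> g \<in> \<Gamma>\<^sub>\<tau>" if "g \<in> \<Gamma>\<^sub>\<tau>" for g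
    using that by (simp add: color_preserving_iff portrait_inv_at)
  show "g \<otimes>\<^bsub>A\<^esub> h \<in> \<Gamma>\<^sub>\<tau>" if "g \<in> \<Gamma>\<^sub>\<tau>" "h \<in> \<Gamma>\<^sub>\<tau>" for g h
    using that by (simp add: color_preserving_iff portrait_mult)
qed

lemma color_preserving_transitive:
  assumes "y \<in> verts T" "z \<in> verts T"
  obtains g where "g \<in> \<Gamma>\<^sub>\<tau>" "fst g y = z"
proof -
  have "is_portrait (\<lambda>_. id)" by (simp add: is_portrait_def permutes_id)
  then obtain g where g: "g \<in> carrier A" "fst g y = z"
    "\<And>x i. x \<in> verts T \<Longrightarrow> i \<in> {1..d} \<Longrightarrow> portrait g x i = id i"
    using aut_exists assms by blast
  have "portrait g x = id" if "x \<in> verts T" for x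
    using g(3)[OF that] by (auto simp: fun_eq_iff portrait_def)
  then show ?thesis using that[of g] g by (simp add: color_preserving_iff)
qed

text \<open>
  Transporting a map along \<open>g\<close> turns periodicity for the coloring \<open>\<tau> \<circ> g\<close> into periodicity
  for \<open>\<tau>\<close>; both hold when the portrait of \<open>g\<close> depends on the map.
\<close>

lemma periodic_translate:
  assumes g: "g \<in> carrier A" and q: "periodic q" and dep: "depends_on q (portrait g)"
  shows "periodic (\<lambda>y. q (fst (inv\<^bsub>A\<^esub> g) y))"
    and "depends_on (\<lambda>y. q (fst (inv\<^bsub>A\<^esub> g) y)) (portrait (inv\<^bsub>A\<^esub> g))"
proof -
  let ?h = "inv\<^bsub>A\<^esub> g"
  have h: "?h \<in> carrier A" using g by simp
  show dep': "depends_on (\<lambda>y. q (fst ?h y)) (portrait ?h)"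
    unfolding depends_on_def
  proof (intro ballI impI)
    fix x y assume xy: "x \<in> verts T" "y \<in> verts T" and eq: "q (fst ?h x) = q (fst ?h y)"
    show "portrait ?h x = portrait ?h y"
      using depends_onD[OF dep aut_fst_in[OF h xy(1)] aut_fst_in[OF h xy(2)] eq]
        portrait_inv_at[OF g xy(1)] portrait_inv_at[OF g xy(2)] by simp
  qed
  show "periodic (\<lambda>y. q (fst ?h y))"
    unfolding periodic_def
  proof (intro conjI ballI impI)
    have "(\<lambda>y. q (fst ?h y)) ` verts T \<subseteq> q ` verts T"
      using aut_fst_in[OF h] by blast
    then show "finite ((\<lambda>y. q (fst ?h y)) ` verts T)"
      using q finite_subset unfolding periodic_def by blast
    fix x y i
    assume xy: "x \<in> verts T" "y \<in> verts T" and i: "i \<in> {1..d}" and eq: "q (fst ?h x) = q (fst ?h y)"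
    have "portrait ?h x = portrait ?h y"
      using depends_onD[OF dep' xy eq] .
    then show "q (fst ?h (nbr x i)) = q (fst ?h (nbr y i))"
      using periodic_nbr[OF q aut_fst_in[OF h xy(1)] aut_fst_in[OF h xy(2)] portrait_in_range[OF h xy(1) i] eq]
        fst_nbr[OF h _ i] xy by simp
  qed
qed

text \<open>
  For a color-preserving automorphism \<open>h\<close>, the map \<open>q \<circ> h\<close> is determined by its value at \<open>v\<close>.  If two
  of them, \<open>h\<close> and \<open>\<delta>\<close>, agree in this value, then the portrait of \<open>g\<close> is the same at \<open>h x\<close>
  and \<open>\<delta> x\<close> for all \<open>x\<close>, hence \<open>g\<close> conjugates \<open>h \<delta>\<inverse>\<close> to a color-preserving automorphism.  So the finitely many values of \<open>q\<close> bound the number of cosets.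
\<close>

lemma color_preserving_covered_if_periodic:
  assumes g: "g \<in> carrier A" and q: "periodic q" and dep: "depends_on q (portrait g)"
  shows "A.covered_by_cosets \<Gamma>\<^sub>\<tau> (A.conj_set (inv\<^bsub>A\<^esub> g) \<Gamma>\<^sub>\<tau>)"
proof -
  define rep where "rep p = (SOME \<delta>. \<delta> \<in> \<Gamma>\<^sub>\<tau> \<and> q (fst \<delta> v) = p)" for p
  have rep: "rep p \<in> \<Gamma>\<^sub>\<tau>" "q (fst (rep p) v) = p" if p: "p \<in> q ` verts T" for p
  proof -
    obtain x where x: "x \<in> verts T" "p = q x" using p by blast
    obtain \<delta> where "\<delta> \<in> \<Gamma>\<^sub>\<tau>" "fst \<delta> v = x"
      using color_preserving_transitive[OF base_vertex x(1)] .
    then show "rep p \<in> \<Gamma>\<^sub>\<tau>" "q (fst (rep p) v) = p"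
      using someI[of "\<lambda>\<delta>. \<delta> \<in> \<Gamma>\<^sub>\<tau> \<and> q (fst \<delta> v) = p" \<delta>] x unfolding rep_def by blast+
  qed
  have "\<Gamma>\<^sub>\<tau> \<subseteq> (\<Union>r\<in>rep ` q ` verts T. A.conj_set (inv\<^bsub>A\<^esub> g) \<Gamma>\<^sub>\<tau> #>\<^bsub>A\<^esub> r)"
  proof
    fix h assume h: "h \<in> \<Gamma>\<^sub>\<tau>"
    have hA: "h \<in> carrier A" using h color_preserving_carrier by blast
    let ?p = "q (fst h v)"
    define \<delta> where "\<delta> = rep ?p"
    have p: "?p \<in> q ` verts T" using hA by simp
    have \<delta>: "\<delta> \<in> \<Gamma>\<^sub>\<tau>" "q (fst \<delta> v) = ?p" using rep[OF p] by (auto simp: \<delta>_def)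
    have \<delta>A: "\<delta> \<in> carrier A" using \<delta> color_preserving_carrier by blast
    have same: "q (fst h x) = q (fst \<delta> x)" if "x \<in> verts T" for x
      using base_vertex that
    proof (induction rule: tree_induct)
      case (step x i)
      then show ?case
        using periodic_nbr[OF q aut_fst_in[OF hA step(1)] aut_fst_in[OF \<delta>A step(1)] step(2)]
          fst_nbr_color_preserving h \<delta>(1) by simp
    qed (use \<delta> in simp)
    define k where "k = g \<otimes>\<^bsub>A\<^esub> h \<otimes>\<^bsub>A\<^esub> inv\<^bsub>A\<^esub> (g \<otimes>\<^bsub>A\<^esub> \<delta>)"
    have kA: "k \<in> carrier A" unfolding k_def using g hA \<delta>A by simp
    have gdA: "g \<otimes>\<^bsub>A\<^esub> \<delta> \<in> carrier A" using g \<delta>A by simp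
    have k_mult: "k \<otimes>\<^bsub>A\<^esub> (g \<otimes>\<^bsub>A\<^esub> \<delta>) = g \<otimes>\<^bsub>A\<^esub> h"
      unfolding k_def using g hA \<delta>A by (simp add: A.m_assoc)
    have "portrait k y = id" if y: "y \<in> verts T" for y
    proof -
      define x where "x = fst (inv\<^bsub>A\<^esub> (g \<otimes>\<^bsub>A\<^esub> \<delta>)) y"
      have x: "x \<in> verts T" "fst (g \<otimes>\<^bsub>A\<^esub> \<delta>) x = y"
        using y gdA fst_fst_inv by (auto simp: x_def)
      have "portrait k y \<circ> portrait (g \<otimes>\<^bsub>A\<^esub> \<delta>) x = portrait (g \<otimes>\<^bsub>A\<^esub> h) x"
        using portrait_mult[OF kA gdA x(1)] k_mult x(2) by simp
      also have "\<dots> = portrait (g \<otimes>\<^bsub>A\<^esub> \<delta>) x"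
        using portrait_mult[OF g hA x(1)] portrait_mult[OF g \<delta>A x(1)] color_preserving_portrait h \<delta>(1)
          depends_onD[OF dep _ _ same[OF x(1)]] x(1) hA \<delta>A by simp
      finally show ?thesis
        using permutes_inv_o(1)[OF portrait_permutes[OF gdA x(1)]] by (metis comp_assoc comp_id id_comp)
    qed
    then have k: "k \<in> \<Gamma>\<^sub>\<tau>" using kA by (simp add: color_preserving_iff)
    have "h = (inv\<^bsub>A\<^esub> g \<otimes>\<^bsub>A\<^esub> k \<otimes>\<^bsub>A\<^esub> inv\<^bsub>A\<^esub> (inv\<^bsub>A\<^esub> g)) \<otimes>\<^bsub>A\<^esub> \<delta>"
    proof -
      have "(inv\<^bsub>A\<^esub> g \<otimes>\<^bsub>A\<^esub> k \<otimes>\<^bsub>A\<^esub> g) \<otimes>\<^bsub>A\<^esub> \<delta> = inv\<^bsub>A\<^esub> g \<otimes>\<^bsub>A\<^esub> (k \<otimes>\<^bsub>A\<^esub> (g \<otimes>\<^bsub>A\<^esub> \<delta>))"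
        using g \<delta>A kA by (simp add: A.m_assoc)
      also have "\<dots> = h"
        unfolding k_mult using g hA by (simp add: A.m_assoc[symmetric])
      finally show ?thesis using g by simp
    qed
    then have "h \<in> A.conj_set (inv\<^bsub>A\<^esub> g) \<Gamma>\<^sub>\<tau> #>\<^bsub>A\<^esub> \<delta>"
      using k A.mem_conj_set unfolding r_coset_def by blast
    then show "h \<in> (\<Union>r\<in>rep ` q ` verts T. A.conj_set (inv\<^bsub>A\<^esub> g) \<Gamma>\<^sub>\<tau> #>\<^bsub>A\<^esub> r)"
      using p unfolding \<delta>_def by blast
  qed
  moreover have "finite (rep ` q ` verts T)" using q by (simp add: periodic_def)
  moreover have "rep ` q ` verts T \<subseteq> carrier A" using rep color_preserving_carrier by blast
  ultimately show ?thesis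
    unfolding A.covered_by_cosets_def by (intro exI conjI)
qed

lemma commensurator_color_preserving_if_periodic:
  assumes g: "g \<in> carrier A" and q: "periodic q" and dep: "depends_on q (portrait g)"
  shows "g \<in> commensurator A \<Gamma>\<^sub>\<tau>"
proof -
  note sub = subgroup_color_preserving
  note H = subgroup.subset[OF sub]
  have g': "inv\<^bsub>A\<^esub> g \<in> carrier A" using g by simp
  have conj: "A.conj_set g (A.conj_set (inv\<^bsub>A\<^esub> g) \<Gamma>\<^sub>\<tau>) = \<Gamma>\<^sub>\<tau>"
    using A.conj_set_mult[OF g g' H] A.conj_set_one[OF H] g by simp
  have "A.covered_by_cosets (A.conj_set g \<Gamma>\<^sub>\<tau>) \<Gamma>\<^sub>\<tau>"
    using A.covered_by_cosets_conj[OF color_preserving_covered_if_periodic[OF assms] g]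
      subgroup.subset[OF A.subgroup_conj_set[OF sub g']] conj by simp
  moreover have "A.covered_by_cosets \<Gamma>\<^sub>\<tau> (A.conj_set g \<Gamma>\<^sub>\<tau>)"
    using color_preserving_covered_if_periodic[OF g' periodic_translate[OF assms]] g by simp
  ultimately show ?thesis
    using g A.commensurable_iff_covered[OF sub A.subgroup_conj_set[OF sub g]]
    by (simp add: A.mem_commensurator)
qed

text \<open>
  The orbits of the finite index subgroup \<open>\<Gamma>\<^sub>\<tau> \<inter> g\<inverse> \<Gamma>\<^sub>\<tau> g\<close> on the vertices provide the periodic map.
\<close>

lemma commensurator_color_preserving_periodic:
  assumes "g \<in> commensurator A \<Gamma>\<^sub>\<tau>"
  obtains q :: "'a \<Rightarrow> 'a set" where "periodic q" "depends_on q (portrait g)"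
proof -
  note sub = subgroup_color_preserving
  note H = subgroup.subset[OF sub]
  have g: "g \<in> carrier A" and comm: "commensurable A \<Gamma>\<^sub>\<tau> (A.conj_set g \<Gamma>\<^sub>\<tau>)"
    using assms by (simp_all add: A.mem_commensurator)
  have g': "inv\<^bsub>A\<^esub> g \<in> carrier A" using g by simp
  let ?K = "A.conj_set (inv\<^bsub>A\<^esub> g) \<Gamma>\<^sub>\<tau>"
  note subK = A.subgroup_conj_set[OF sub g']
  define \<Delta> where "\<Delta> = \<Gamma>\<^sub>\<tau> \<inter> ?K"
  have sub\<Delta>: "subgroup \<Delta> A"
    unfolding \<Delta>_def using sub subK by (rule A.subgroups_Inter_pair)
  have "A.conj_set (inv\<^bsub>A\<^esub> g) (A.conj_set g \<Gamma>\<^sub>\<tau>) = \<Gamma>\<^sub>\<tau>"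
    using A.conj_set_mult[OF g' g H] A.conj_set_one[OF H] g by simp
  then have "commensurable A ?K \<Gamma>\<^sub>\<tau>"
    using A.commensurable_conj[OF sub A.subgroup_conj_set[OF sub g] g' comm] by simp
  then have "finite_index_in A (\<Gamma>\<^sub>\<tau> \<inter> \<Delta>) \<Gamma>\<^sub>\<tau>"
    unfolding commensurable_def \<Delta>_def by (simp add: Int_commute)
  then obtain R where R: "finite R" "R \<subseteq> carrier A" "\<Gamma>\<^sub>\<tau> \<subseteq> (\<Union>r\<in>R. \<Delta> #>\<^bsub>A\<^esub> r)"
    unfolding A.finite_index_iff_covered[OF sub sub\<Delta>] A.covered_by_cosets_def by blast
  have \<Delta>_carrier: "\<delta> \<in> carrier A" if "\<delta> \<in> \<Delta>" for \<delta>
    using subgroup.mem_carrier[OF sub\<Delta> that] .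
  define q where "q x = (\<lambda>\<delta>. fst \<delta> x) ` \<Delta>" for x
  have q_self: "x \<in> q x" if "x \<in> verts T" for x
    unfolding q_def using subgroup.one_closed[OF sub\<Delta>] fst_one[OF that] by (metis imageI)
  have q_translate: "q (fst \<delta> x) = q x" if \<delta>: "\<delta> \<in> \<Delta>" and x: "x \<in> verts T" for \<delta> x
  proof
    show "q (fst \<delta> x) \<subseteq> q x"
    proof
      fix y assume "y \<in> q (fst \<delta> x)"
      then obtain \<epsilon> where \<epsilon>: "\<epsilon> \<in> \<Delta>" "y = fst \<epsilon> (fst \<delta> x)" by (auto simp: q_def)
      then have "\<epsilon> \<otimes>\<^bsub>A\<^esub> \<delta> \<in> \<Delta>" "fst (\<epsilon> \<otimes>\<^bsub>A\<^esub> \<delta>) x = y"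
        using subgroup.m_closed[OF sub\<Delta> \<epsilon>(1) \<delta>] fst_mult[OF _ _ x] \<Delta>_carrier \<delta> by auto
      then show "y \<in> q x" unfolding q_def by (metis imageI)
    qed
    show "q x \<subseteq> q (fst \<delta> x)"
    proof
      fix y assume "y \<in> q x"
      then obtain \<epsilon> where \<epsilon>: "\<epsilon> \<in> \<Delta>" "y = fst \<epsilon> x" by (auto simp: q_def)
      have "\<epsilon> \<otimes>\<^bsub>A\<^esub> inv\<^bsub>A\<^esub> \<delta> \<in> \<Delta>"
        using \<epsilon> \<delta> sub\<Delta> by (simp add: subgroup.m_closed subgroup.m_inv_closed)
      moreover have "fst (\<epsilon> \<otimes>\<^bsub>A\<^esub> inv\<^bsub>A\<^esub> \<delta>) (fst \<delta> x) = y"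
        using \<epsilon> \<delta> x \<Delta>_carrier by (simp add: fst_mult fst_inv_fst)
      ultimately show "y \<in> q (fst \<delta> x)" unfolding q_def by (metis imageI)
    qed
  qed
  have q_eqD: "\<exists>\<delta>\<in>\<Delta>. y = fst \<delta> x" if "q x = q y" "y \<in> verts T" for x y
    using q_self[OF that(2)] that(1) unfolding q_def by auto
  have "periodic q"
    unfolding periodic_def
  proof (intro conjI ballI impI)
    have "q ` verts T \<subseteq> (\<lambda>r. q (fst r v)) ` R"
    proof (intro subsetI, elim imageE)
      fix p x assume p: "p = q x" and x: "x \<in> verts T"
      obtain h where h: "h \<in> \<Gamma>\<^sub>\<tau>" "fst h v = x"
        using color_preserving_transitive[OF base_vertex x] .
      then obtain r \<delta> where r: "r \<in> R" "\<delta> \<in> \<Delta>" "h = \<delta> \<otimes>\<^bsub>A\<^esub> r"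
        using R(3) by (auto simp: r_coset_def)
      have rA: "r \<in> carrier A" using r(1) R(2) by blast
      have "p = q (fst \<delta> (fst r v))"
        using p h(2) r(3) fst_mult[OF \<Delta>_carrier[OF r(2)] rA base_vertex] by simp
      then have "p = q (fst r v)"
        using q_translate[OF r(2) aut_fst_in[OF rA base_vertex]] by simp
      then show "p \<in> (\<lambda>r. q (fst r v)) ` R" using r(1) by blast
    qed
    then show "finite (q ` verts T)" using R(1) finite_surj by blast
    fix x y i assume xy: "x \<in> verts T" "y \<in> verts T" and i: "i \<in> {1..d}" and eq: "q x = q y"
    obtain \<delta> where \<delta>: "\<delta> \<in> \<Delta>" "y = fst \<delta> x" using q_eqD[OF eq xy(2)] by blast
    then have "fst \<delta> (nbr x i) = nbr y i"
      using fst_nbr_color_preserving xy i by (simp add: \<Delta>_def)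
    then show "q (nbr x i) = q (nbr y i)"
      using q_translate[OF \<delta>(1) nbr_in_verts[OF xy(1) i]] by simp
  qed
  moreover have "depends_on q (portrait g)"
    unfolding depends_on_def
  proof (intro ballI impI)
    fix x y assume xy: "x \<in> verts T" "y \<in> verts T" and eq: "q x = q y"
    obtain \<delta> where \<delta>: "\<delta> \<in> \<Delta>" "y = fst \<delta> x" using q_eqD[OF eq xy(2)] by blast
    obtain k where k: "k \<in> \<Gamma>\<^sub>\<tau>" "\<delta> = inv\<^bsub>A\<^esub> g \<otimes>\<^bsub>A\<^esub> k \<otimes>\<^bsub>A\<^esub> g"
      using \<delta>(1) g unfolding \<Delta>_def by (auto simp: A.mem_conj_set)
    have kA: "k \<in> carrier A" using k(1) color_preserving_carrier by blast
    have "g \<otimes>\<^bsub>A\<^esub> \<delta> = k \<otimes>\<^bsub>A\<^esub> g"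
      unfolding k(2) using g kA by (simp add: A.m_assoc[symmetric])
    then have "portrait g y \<circ> portrait \<delta> x = portrait k (fst g x) \<circ> portrait g x"
      using portrait_mult[OF g \<Delta>_carrier[OF \<delta>(1)] xy(1)] portrait_mult[OF kA g xy(1)] \<delta>(2) by simp
    then show "portrait g x = portrait g y"
      using color_preserving_portrait k(1) \<delta>(1) xy g by (simp add: \<Delta>_def)
  qed
  ultimately show ?thesis by (rule that)
qed

end

section \<open>The automorphism of a pair of colorings\<close>

lemma (in colored_graph) edge_at_bij_betw:
  assumes "x \<in> verts G"
  shows "bij_betw (edge_at x) {1..d} (incident_edges G x)"
proof (rule bij_betw_byWitness[where f' = c])
  show "\<forall>i\<in>{1..d}. c (edge_at x i) = i"
    using edge_at(2)[OF assms] by blast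
  show "\<forall>e\<in>incident_edges G x. edge_at x (c e) = e"
    using edge_eq_edge_at by (auto simp: incident_edges_def)
  show "edge_at x ` {1..d} \<subseteq> incident_edges G x"
    using edge_at[OF assms] by (auto simp: incident_edges_def)
  show "c ` incident_edges G x \<subseteq> {1..d}"
    using color_in_range by (auto simp: incident_edges_def)
qed

lemma nbr_recolored:
  assumes "colored_graph G d c\<^sub>1" "colored_graph G d c\<^sub>2" "x \<in> verts G" "i \<in> {1..d}"
  defines "e \<equiv> colored_graph.edge_at G c\<^sub>1 x i"
  shows "colored_graph.edge_at G c\<^sub>2 x (c\<^sub>2 e) = e"
    and "colored_graph.nbr G c\<^sub>2 x (c\<^sub>2 e) = colored_graph.nbr G c\<^sub>1 x i"
proof -
  interpret c1: colored_graph G d c\<^sub>1 by fact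
  interpret c2: colored_graph G d c\<^sub>2 by fact
  have e: "e \<in> edges G" "x \<in> ends G e" "ends G e = {x, c1.nbr x i}"
    using c1.edge_at[OF assms(3,4)] c1.ends_edge_at[OF assms(3,4)] by (simp_all add: e_def)
  show eq: "c2.edge_at x (c\<^sub>2 e) = e"
    using c2.edge_eq_edge_at[OF e(1,2)] by simp
  have "{x, c2.nbr x (c\<^sub>2 e)} = {x, c1.nbr x i}"
    using c2.ends_edge_at(1)[OF assms(3) c2.color_in_range[OF e(1)]] eq e(3) by simp
  then show "c2.nbr x (c\<^sub>2 e) = c1.nbr x i"
    using c2.ends_edge_at(2)[OF assms(3) c2.color_in_range[OF e(1)]] by (metis doubleton_eq_iff)
qed

context colored_tree
begin

definition is_colored_covering ::
    "('c, 'd) mgraph \<Rightarrow> 'c \<Rightarrow> ('d \<Rightarrow> nat) \<Rightarrow> ('a, 'b, 'c, 'd) gmap \<Rightarrow> bool" where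
  "is_colored_covering G u c p \<longleftrightarrow>
     p \<in> covering_maps T G \<and> fst p v = u \<and> (\<forall>e\<in>edges T. c (snd p e) = \<tau> e)"

lemma colored_covering_step:
  assumes G: "colored_graph G d c" and p: "is_colored_covering G u c p"
    and x: "x \<in> verts T"
  shows "fst p x \<in> verts G"
    and "i \<in> {1..d} \<Longrightarrow> snd p (edge_at x i) = colored_graph.edge_at G c (fst p x) i"
    and "i \<in> {1..d} \<Longrightarrow> fst p (nbr x i) = colored_graph.nbr G c (fst p x) i"
proof -
  interpret G: colored_graph G d c by fact
  have hom: "p \<in> graph_hom T G" and col: "\<And>e. e \<in> edges T \<Longrightarrow> c (snd p e) = \<tau> e"
    using p by (auto simp: is_colored_covering_def covering_maps_def)
  show px: "fst p x \<in> verts G"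
    using hom x by (auto simp: graph_hom_def)
  have *: "snd p (edge_at x i) = G.edge_at (fst p x) i \<and> fst p (nbr x i) = G.nbr (fst p x) i"
    if i: "i \<in> {1..d}"
  proof -
    let ?e = "edge_at x i"
    have e: "?e \<in> edges T" "\<tau> ?e = i" "ends T ?e = {x, nbr x i}"
      using edge_at[OF x i] ends_edge_at[OF x i] by auto
    have pe: "snd p ?e \<in> edges G" "ends G (snd p ?e) = {fst p x, fst p (nbr x i)}"
      using hom e by (auto simp: graph_hom_def)
    then have eq: "snd p ?e = G.edge_at (fst p x) i"
      using G.edge_eq_edge_at[of "snd p ?e" "fst p x"] col[OF e(1)] e(2) by simp
    have "{fst p x, fst p (nbr x i)} = {fst p x, G.nbr (fst p x) i}"
      using pe(2) eq G.ends_edge_at(1)[OF px i] by simp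
    then have "fst p (nbr x i) = G.nbr (fst p x) i"
      using G.ends_edge_at(2)[OF px i] by (metis doubleton_eq_iff)
    with eq show ?thesis by simp
  qed
  then show "i \<in> {1..d} \<Longrightarrow> snd p (edge_at x i) = G.edge_at (fst p x) i"
    "i \<in> {1..d} \<Longrightarrow> fst p (nbr x i) = G.nbr (fst p x) i"
    by simp_all
qed

lemma colored_covering_unique:
  assumes G: "colored_graph G d c" and p: "is_colored_covering G u c p" and p': "is_colored_covering G u c p'"
  shows "p = p'"
proof -
  note step = colored_covering_step[OF G p] and step' = colored_covering_step[OF G p']
  have fst: "fst p x = fst p' x" if "x \<in> verts T" for x
    using base_vertex that
  proof (induction rule: tree_induct)
    case base
    show ?case using p p' by (simp add: is_colored_covering_def)
  next
    case (step x i)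
    then show ?case using colored_covering_step(3)[OF G p] colored_covering_step(3)[OF G p'] by simp
  qed
  have snd: "snd p e = snd p' e" if "e \<in> edges T" for e
    using that
  proof (rule edge_cases)
    fix x assume x: "x \<in> verts T" "\<tau> e \<in> {1..d}" "e = edge_at x (\<tau> e)"
    then show "snd p e = snd p' e"
      using step(2)[OF x(1,2)] step'(2)[OF x(1,2)] fst[OF x(1)] by simp
  qed
  have "fst p \<in> extensional (verts T)" "fst p' \<in> extensional (verts T)"
    "snd p \<in> extensional (edges T)" "snd p' \<in> extensional (edges T)"
    using p p' by (auto simp: is_colored_covering_def covering_maps_def graph_hom_def PiE_def)
  then show ?thesis
    using fst snd by (intro prod_eqI extensionalityI[of _ "verts T"] extensionalityI[of _ "edges T"])
qed

lemma colored_covering_exists: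
  assumes G: "colored_graph G d c" and conn: "connected_mgraph G" and u: "u \<in> verts G"
  shows "\<exists>p. is_colored_covering G u c p"
proof -
  interpret G: colored_graph G d c by fact
  let ?V = "verts T"
  obtain f where f: "f v = u" "\<And>x. x \<in> ?V \<Longrightarrow> f x \<in> verts G"
    "\<And>x i. x \<in> ?V \<Longrightarrow> i \<in> {1..d} \<Longrightarrow> f (nbr x i) = G.nbr (f x) i"
    by (rule equivariant_map_exists[of "verts G" G.nbr v u]) (use u in auto)
  define k where "k e = G.edge_at (f (SOME x. x \<in> ends T e)) (\<tau> e)" for e
  have k: "k (edge_at x i) = G.edge_at (f x) i" if x: "x \<in> ?V" and i: "i \<in> {1..d}" for x i
  proof -
    define x' where "x' = (SOME x'. x' \<in> ends T (edge_at x i))"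
    have "x' \<in> ends T (edge_at x i)"
      unfolding x'_def using edge_at(3)[OF that] by (rule someI)
    then have "x' = x \<or> x' = nbr x i"
      using ends_edge_at(1)[OF that] by simp
    then have "G.edge_at (f x') i = G.edge_at (f x) i"
      using that f G.edge_at_nbr[of "f x" i] by auto
    then show ?thesis
      using edge_at(2)[OF that] unfolding k_def x'_def by simp
  qed
  have k_edge: "k e \<in> edges G" "c (k e) = \<tau> e" "ends G (k e) = f ` ends T e" if e: "e \<in> edges T" for e
  proof -
    from e obtain x where x: "x \<in> ?V" "\<tau> e \<in> {1..d}" "e = edge_at x (\<tau> e)" by (rule edge_cases)
    have ke: "k e = G.edge_at (f x) (\<tau> e)" using k[OF x(1,2)] x(3) by simp
    show "k e \<in> edges G" "c (k e) = \<tau> e"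
      unfolding ke using G.edge_at[OF f(2)[OF x(1)] x(2)] by simp_all
    have "ends T e = {x, nbr x (\<tau> e)}" using ends_edge_at(1)[OF x(1,2)] x(3) by simp
    then show "ends G (k e) = f ` ends T e"
      unfolding ke using G.ends_edge_at(1)[OF f(2)[OF x(1)] x(2)] f(3)[OF x(1,2)] by simp
  qed
  let ?p = "(restrict f ?V, restrict k (edges T))"
  have surj: "f ` ?V = verts G"
  proof
    show "f ` ?V \<subseteq> verts G" using f(2) by blast
    show "verts G \<subseteq> f ` ?V"
    proof
      fix y assume "y \<in> verts G"
      with conn u show "y \<in> f ` ?V"
      proof (induction rule: G.nbr_induct)
        case base
        show ?case using f(1) base_vertex by blast
      next
        case (step y i)
        then obtain x where "x \<in> ?V" "y = f x" by blast
        then show ?case using f(3)[of x i] step(2) by (metis imageI nbr_in_verts)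
      qed
    qed
  qed
  have "?p \<in> graph_hom T G"
  proof -
    have "ends G (restrict k (edges T) e) = restrict f ?V ` ends T e" if e: "e \<in> edges T" for e
    proof -
      have "restrict f ?V ` ends T e = f ` ends T e"
        by (rule image_cong) (use ends_in_verts e in auto)
      then show ?thesis using k_edge e by simp
    qed
    then show ?thesis
      using f(2) k_edge(1) by (auto simp: graph_hom_def)
  qed
  moreover have "bij_betw (snd ?p) (incident_edges T x) (incident_edges G (fst ?p x))" if x: "x \<in> ?V" for x
  proof -
    have "bij_betw (G.edge_at (f x) \<circ> \<tau>) (incident_edges T x) (incident_edges G (f x))"
      by (rule bij_betw_trans[OF coloring_bij_betw[OF x] G.edge_at_bij_betw[OF f(2)[OF x]]])
    moreover have "(G.edge_at (f x) \<circ> \<tau>) e = restrict k (edges T) e" if e: "e \<in> incident_edges T x" for e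
    proof -
      have e: "e \<in> edges T" "e = edge_at x (\<tau> e)"
        using e edge_eq_edge_at by (auto simp: incident_edges_def)
      then show ?thesis
        using k[OF x color_in_range[OF e(1)]] by simp
    qed
    ultimately show ?thesis
      using x bij_betw_cong[of "incident_edges T x" "G.edge_at (f x) \<circ> \<tau>" "restrict k (edges T)"] by simp
  qed
  ultimately have "?p \<in> covering_maps T G"
    using surj by (simp add: covering_maps_def)
  then have "is_colored_covering G u c ?p"
    using f(1) k_edge by (simp add: is_colored_covering_def)
  then show ?thesis by blast
qed

lemma is_colored_covering_iff:
  assumes "colored_graph G d c" "connected_mgraph G" "u \<in> verts G"
  shows "is_colored_covering G u c p \<longleftrightarrow> p = colored_covering T \<tau> v G u c"
proof -
  have "\<exists>!p. is_colored_covering G u c p"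
    using colored_covering_exists[OF assms] colored_covering_unique[OF assms(1)] by blast
  moreover have "colored_covering T \<tau> v G u c = (THE p. is_colored_covering G u c p)"
    by (simp add: colored_covering_def is_colored_covering_def)
  ultimately show ?thesis by (metis theI')
qed

text \<open>
  The equation \<open>\<pi>\<^sub>2 \<circ> g = \<pi>\<^sub>1\<close> says that the color of the image of an edge \<open>e\<close> is the second color of
  \<open>\<pi>\<^sub>1 e\<close>.  This determines the portrait, and conversely the automorphism with this portrait
  satisfies the equation, because \<open>\<pi>\<^sub>2 \<circ> g\<close> and \<open>\<pi>\<^sub>1\<close> then follow the same edges of \<open>G\<close>.
\<close>

lemma recoloring_aut_portrait:
  assumes G1: "colored_graph G d c\<^sub>1" and G2: "colored_graph G d c\<^sub>2"
    and conn: "connected_mgraph G" and u: "u \<in> verts G"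
    and p: "is_colored_covering G u c\<^sub>1 p"
  defines "g \<equiv> recoloring_aut T \<tau> v G u c\<^sub>1 c\<^sub>2"
  shows "g \<in> carrier A" and "fst g v = v"
    and "\<And>x i. x \<in> verts T \<Longrightarrow> i \<in> {1..d} \<Longrightarrow>
           portrait g x i = c\<^sub>2 (colored_graph.edge_at G c\<^sub>1 (fst p x) i)"
proof -
  interpret G1: colored_graph G d c\<^sub>1 by fact
  interpret G2: colored_graph G d c\<^sub>2 by fact
  obtain p' where p': "is_colored_covering G u c\<^sub>2 p'"
    using colored_covering_exists[OF G2 conn u] by blast
  note step = colored_covering_step[OF G1 p] and step' = colored_covering_step[OF G2 p']
  define P where "P g \<longleftrightarrow> g \<in> carrier A \<and> fst g v = v \<and>
    (\<forall>x\<in>verts T. fst p' (fst g x) = fst p x) \<and> (\<forall>e\<in>edges T. snd p' (snd g e) = snd p e)" for g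
  define \<sigma> where "\<sigma> x i = (if i \<in> {1..d} then c\<^sub>2 (G1.edge_at (fst p x) i) else i)" for x i
  have P_portrait: "portrait g x i = \<sigma> x i" if "P g" "x \<in> verts T" "i \<in> {1..d}" for g x i
  proof -
    let ?e = "edge_at x i"
    have e: "?e \<in> edges T" using edge_at(1) that by blast
    have "snd g ?e \<in> edges T"
      using aut_snd_in[of g T ?e] e that(1) by (simp add: P_def)
    then have "portrait g x i = c\<^sub>2 (snd p' (snd g ?e))"
      using p' that(3) by (simp only: portrait_def is_colored_covering_def if_True)
    also have "\<dots> = c\<^sub>2 (snd p ?e)" using that(1) e by (simp add: P_def)
    finally show ?thesis using step(2)[OF that(2,3)] that(3) by (simp add: \<sigma>_def)
  qed
  have "is_portrait \<sigma>"
    unfolding is_portrait_def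
  proof (intro ballI conjI)
    fix x assume x: "x \<in> verts T"
    have "bij_betw (c\<^sub>2 \<circ> G1.edge_at (fst p x)) {1..d} {1..d}"
      by (rule bij_betw_trans[OF G1.edge_at_bij_betw[OF step(1)[OF x]] G2.coloring_bij_betw[OF step(1)[OF x]]])
    then have "bij_betw (\<sigma> x) {1..d} {1..d}"
      using bij_betw_cong[of "{1..d}" "c\<^sub>2 \<circ> G1.edge_at (fst p x)" "\<sigma> x"] by (simp add: \<sigma>_def)
    then show "\<sigma> x permutes {1..d}"
      by (rule bij_imp_permutes) (auto simp: \<sigma>_def)
    show "\<sigma> (nbr x i) i = \<sigma> x i" if i: "i \<in> {1..d}" for i
      using step(1,3)[OF x] G1.edge_at_nbr i by (simp add: \<sigma>_def)
  qed
  then obtain g\<^sub>0 where g0: "g\<^sub>0 \<in> carrier A" "fst g\<^sub>0 v = v"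
    "\<And>x i. x \<in> verts T \<Longrightarrow> i \<in> {1..d} \<Longrightarrow> portrait g\<^sub>0 x i = \<sigma> x i"
    using aut_exists base_vertex by blast
  have fst0: "fst p' (fst g\<^sub>0 x) = fst p x" if "x \<in> verts T" for x
    using base_vertex that
  proof (induction rule: tree_induct)
    case base
    show ?case using p p' g0(2) by (simp add: is_colored_covering_def)
  next
    case (step x i)
    have "fst p' (fst g\<^sub>0 (nbr x i)) = G2.nbr (fst p x) (\<sigma> x i)"
      using fst_nbr[OF g0(1) step(1,2)] g0(3)[OF step(1,2)] step(3)
        step'(3)[OF aut_fst_in[OF g0(1) step(1)] portrait_in_range[OF g0(1) step(1,2)]] by simp
    also have "\<dots> = G1.nbr (fst p x) i"
      using nbr_recolored(2)[OF G1 G2 colored_covering_step(1)[OF G1 p step(1)] step(2)] step(2)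
      by (simp add: \<sigma>_def)
    finally show ?case
      using colored_covering_step(3)[OF G1 p step(1,2)] by simp
  qed
  have snd0: "snd p' (snd g\<^sub>0 e) = snd p e" if "e \<in> edges T" for e
    using that
  proof (rule edge_cases)
    fix x assume x': "x \<in> verts T" "\<tau> e \<in> {1..d}" "e = edge_at x (\<tau> e)"
    define i where "i = \<tau> e"
    have x: "x \<in> verts T" "i \<in> {1..d}" "e = edge_at x i" using x' by (simp_all add: i_def)
    have "snd p' (snd g\<^sub>0 e) = G2.edge_at (fst p x) (\<sigma> x i)"
      using snd_edge_at[OF g0(1) x(1,2)] g0(3)[OF x(1,2)] x(3) fst0[OF x(1)]
        step'(2)[OF aut_fst_in[OF g0(1) x(1)] portrait_in_range[OF g0(1) x(1,2)]] by simp
    also have "\<dots> = G1.edge_at (fst p x) i"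
      using nbr_recolored(1)[OF G1 G2 step(1)[OF x(1)] x(2)] x(2) by (simp add: \<sigma>_def)
    finally show ?thesis
      using step(2)[OF x(1,2)] x(3) by simp
  qed
  have P0: "P g\<^sub>0" using g0 fst0 snd0 by (simp add: P_def)
  have unique: "h = g\<^sub>0" if "P h" for h
    by (rule aut_eqI[of _ _ v]) (use that P0 P_portrait g0 in \<open>auto simp: P_def\<close>)
  have "g = (THE g. P g)"
    using p p' is_colored_covering_iff[OF G1 conn u] is_colored_covering_iff[OF G2 conn u]
    by (simp add: g_def recoloring_aut_def P_def Let_def)
  also have "\<dots> = g\<^sub>0"
    using P0 unique by (rule the_equality)
  finally have "g = g\<^sub>0" .
  then show "g \<in> carrier A" "fst g v = v"
    "\<And>x i. x \<in> verts T \<Longrightarrow> i \<in> {1..d} \<Longrightarrow> portrait g x i = c\<^sub>2 (G1.edge_at (fst p x) i)"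
    using g0 by (simp_all add: \<sigma>_def)
qed

lemma recoloring_aut_in_commensurator:
  assumes G1: "colored_graph G d c\<^sub>1" and G2: "colored_graph G d c\<^sub>2"
    and fin: "finite (verts G)" and conn: "connected_mgraph G" and u: "u \<in> verts G"
  shows "recoloring_aut T \<tau> v G u c\<^sub>1 c\<^sub>2 \<in> commensurator A \<Gamma>\<^sub>\<tau>"
proof -
  obtain p where p: "is_colored_covering G u c\<^sub>1 p"
    using colored_covering_exists[OF G1 conn u] by blast
  note step = colored_covering_step[OF G1 p]
  note g = recoloring_aut_portrait[OF G1 G2 conn u p]
  have "finite (fst p ` verts T)"
    by (rule finite_subset[OF _ fin]) (use step(1) in blast)
  then have "periodic (fst p)"
    unfolding periodic_def using step(3) by metis
  moreover have "depends_on (fst p) (portrait (recoloring_aut T \<tau> v G u c\<^sub>1 c\<^sub>2))"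
    unfolding depends_on_def
  proof (intro ballI impI ext)
    fix x y i assume "x \<in> verts T" "y \<in> verts T" "fst p x = fst p y"
    then show "portrait (recoloring_aut T \<tau> v G u c\<^sub>1 c\<^sub>2) x i
        = portrait (recoloring_aut T \<tau> v G u c\<^sub>1 c\<^sub>2) y i"
      using g(3)[of x i] g(3)[of y i]
      by (cases "i \<in> {1..d}") (simp, simp only: portrait_def if_False)
  qed
  ultimately show ?thesis
    using commensurator_color_preserving_if_periodic g(1) by blast
qed

end

section \<open>Kempe switches\<close>

definition bichromatic_subgraph :: "('a, 'b) mgraph \<Rightarrow> ('b \<Rightarrow> nat) \<Rightarrow> nat \<Rightarrow> nat \<Rightarrow> ('a, 'b) mgraph" where
  "bichromatic_subgraph G c i j = G\<lparr>edges := {e \<in> edges G. c e = i \<or> c e = j}\<rparr>"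

lemma bichromatic_cycles_eq:
  "bichromatic_cycles G c i j = component_at (bichromatic_subgraph G c i j) ` verts G"
  by (simp add: bichromatic_cycles_def components_def bichromatic_subgraph_def)

text \<open>
  Edges of the other colors are fixed by the transposition, so a switch may be described as
  transposing the colors of all edges at the vertices of the cycle.
\<close>

lemma kempe_switch_at:
  assumes G: "mgraph G" and z: "z \<in> verts G" and e: "e \<in> edges G" "a \<in> ends G e"
  shows "kempe_switch i j (component_at (bichromatic_subgraph G c i j) z) c e
    = (if (adjacent (bichromatic_subgraph G c i j))\<^sup>*\<^sup>* z a then Transposition.transpose i j (c e) else c e)"
proof (cases "c e = i \<or> c e = j")
  case False
  then show ?thesis by (auto simp: kempe_switch_def)
next
  case True
  let ?H = "bichromatic_subgraph G c i j"
  have "card (ends G e) = 2" "ends G e \<subseteq> verts G" using G e(1) by (auto simp: mgraph_def)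
  then obtain b where ab: "ends G e = {a, b}" "a \<in> verts G" "b \<in> verts G"
    using e(2) by (metis card_2_iff doubleton_eq_iff insert_iff insert_subset singletonD)
  have eH: "e \<in> edges ?H" "ends ?H e = {a, b}"
    using e True ab by (simp_all add: bichromatic_subgraph_def)
  then have "adjacent ?H a b" by (auto simp: adjacent_def)
  then have "(adjacent ?H)\<^sup>*\<^sup>* z a \<Longrightarrow> (adjacent ?H)\<^sup>*\<^sup>* z b" by (rule rtranclp.rtrancl_into_rtrancl[rotated])
  then have "e \<in> edges (component_at ?H z) \<longleftrightarrow> (adjacent ?H)\<^sup>*\<^sup>* z a"
    using eH ab by (auto simp: component_at_def Let_def bichromatic_subgraph_def)
  then show ?thesis by (simp add: kempe_switch_def)
qed

lemma (in colored_graph) colored_graph_kempe_switch: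
  assumes "\<gamma> \<in> bichromatic_cycles G c i j" "i \<in> {1..d}" "j \<in> {1..d}"
  shows "colored_graph G d (kempe_switch i j \<gamma> c)"
proof -
  let ?H = "bichromatic_subgraph G c i j"
  obtain z where z: "z \<in> verts G" "\<gamma> = component_at ?H z"
    using assms(1) by (auto simp: bichromatic_cycles_eq)
  note at = kempe_switch_at[OF mgraph z(1), of _ _ i j c, folded z(2)]
  have "kempe_switch i j \<gamma> c e \<in> {1..d}" if "e \<in> edges G" for e
    using color_in_range[OF that] assms(2,3) by (auto simp: kempe_switch_def Transposition.transpose_def)
  moreover have "kempe_switch i j \<gamma> c e \<noteq> kempe_switch i j \<gamma> c f"
    if "e \<in> edges G" "f \<in> edges G" "e \<noteq> f" and ends: "ends G e \<inter> ends G f \<noteq> {}" for e f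
  proof -
    obtain a where a: "a \<in> ends G e" "a \<in> ends G f" using ends by blast
    have "c e \<noteq> c f"
      using proper that by (auto simp: proper_edge_coloring_def)
    then show ?thesis
      using at[OF that(1) a(1)] at[OF that(2) a(2)] by (auto dest: transpose_eq_imp_eq)
  qed
  ultimately have "proper_edge_coloring G d (kempe_switch i j \<gamma> c)"
    by (auto simp: proper_edge_coloring_def)
  then show ?thesis
    using mgraph regular degree_pos by unfold_locales
qed

section \<open>Periodic Kempe switches of the tree\<close>

context colored_tree
begin

lemma portrait_outside: "i \<notin> {1..d} \<Longrightarrow> portrait g x i = i"
  by (simp only: portrait_def if_False)

text \<open>
  An edge of the quotient is coded by the images of its two ends together with its color, so that
  ends and color can be read off from the code.
\<close>

definition quotient_edge :: "('a \<Rightarrow> nat) \<Rightarrow> 'b \<Rightarrow> nat" where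
  "quotient_edge q e = prod_encode (set_encode (q ` ends T e), \<tau> e)"

definition quotient_graph :: "('a \<Rightarrow> nat) \<Rightarrow> (nat, nat) mgraph" where
  "quotient_graph q = \<lparr>verts = q ` verts T, edges = quotient_edge q ` edges T,
     ends = (\<lambda>n. set_decode (fst (prod_decode n)))\<rparr>"

definition loopless :: "('a \<Rightarrow> 'q) \<Rightarrow> bool" where
  "loopless q \<longleftrightarrow> (\<forall>x\<in>verts T. \<forall>i\<in>{1..d}. q (nbr x i) \<noteq> q x)"

definition quotient_color :: "nat \<Rightarrow> nat" where
  "quotient_color n = snd (prod_decode n)"

lemma quotient_color_edge [simp]: "quotient_color (quotient_edge q e) = \<tau> e"
  by (simp add: quotient_color_def quotient_edge_def)

lemma ends_quotient_edge:
  assumes "e \<in> edges T"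
  shows "ends (quotient_graph q) (quotient_edge q e) = q ` ends T e"
proof -
  have "card (ends T e) = 2" using mgraph assms by (simp add: mgraph_def)
  then have "finite (q ` ends T e)" by (metis card.infinite finite_imageI zero_neq_numeral)
  then show ?thesis by (simp add: quotient_graph_def quotient_edge_def)
qed

lemma quotient_edge_cong:
  assumes q: "periodic q" and "x \<in> verts T" "y \<in> verts T" "i \<in> {1..d}" "q x = q y"
  shows "quotient_edge q (edge_at x i) = quotient_edge q (edge_at y i)"
  using periodic_nbr[OF assms(1-5)] assms edge_at(2) ends_edge_at(1) by (simp add: quotient_edge_def)

lemma incident_edges_quotient:
  assumes q: "periodic q" and x: "x \<in> verts T"
  shows "incident_edges (quotient_graph q) (q x) = (\<lambda>i. quotient_edge q (edge_at x i)) ` {1..d}"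
proof (intro equalityI subsetI)
  fix n assume "n \<in> incident_edges (quotient_graph q) (q x)"
  then obtain e where e: "e \<in> edges T" "n = quotient_edge q e" "q x \<in> q ` ends T e"
    using ends_quotient_edge by (auto simp: incident_edges_def quotient_graph_def)
  then obtain y where y: "y \<in> ends T e" "q x = q y" by blast
  then have "n = quotient_edge q (edge_at x (\<tau> e))"
    using quotient_edge_cong[OF q ends_in_verts[OF e(1) y(1)] x color_in_range[OF e(1)]]
      edge_eq_edge_at[OF e(1) y(1)] e(2) by simp
  then show "n \<in> (\<lambda>i. quotient_edge q (edge_at x i)) ` {1..d}"
    using color_in_range[OF e(1)] by blast
next
  fix n assume "n \<in> (\<lambda>i. quotient_edge q (edge_at x i)) ` {1..d}"
  then obtain i where i: "i \<in> {1..d}" "n = quotient_edge q (edge_at x i)" by blast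
  then have "q x \<in> ends (quotient_graph q) n"
    using ends_quotient_edge edge_at[OF x i(1)] by simp
  then show "n \<in> incident_edges (quotient_graph q) (q x)"
    using i edge_at(1)[OF x i(1)] by (simp add: incident_edges_def quotient_graph_def)
qed

lemma colored_graph_quotient:
  assumes q: "periodic q" and no_loops: "loopless q"
  shows "colored_graph (quotient_graph q) d quotient_color"
proof
  let ?G = "quotient_graph q"
  show "mgraph ?G"
    unfolding mgraph_def
  proof
    fix n assume "n \<in> edges ?G"
    then obtain e where e: "e \<in> edges T" "n = quotient_edge q e" by (auto simp: quotient_graph_def)
    from e(1) obtain x where x: "x \<in> verts T" "\<tau> e \<in> {1..d}" "e = edge_at x (\<tau> e)" by (rule edge_cases)
    have "ends T e = {x, nbr x (\<tau> e)}" using ends_edge_at(1)[OF x(1,2)] x(3) by simp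
    then have "ends ?G n = {q x, q (nbr x (\<tau> e))}"
      using ends_quotient_edge[OF e(1)] e(2) by simp
    moreover have "q (nbr x (\<tau> e)) \<noteq> q x"
      using no_loops x(1,2) unfolding loopless_def by blast
    ultimately show "ends ?G n \<subseteq> verts ?G \<and> card (ends ?G n) = 2"
      using x(1) nbr_in_verts[OF x(1,2)] by (auto simp: quotient_graph_def)
  qed
  show "regular_mgraph d ?G"
    unfolding regular_mgraph_def
  proof
    fix a assume "a \<in> verts ?G"
    then obtain x where x: "x \<in> verts T" "a = q x" by (auto simp: quotient_graph_def)
    have "inj_on (\<lambda>i. quotient_edge q (edge_at x i)) {1..d}"
      by (rule inj_on_inverseI[of _ quotient_color]) (use edge_at(2) x in simp)
    then show "card (incident_edges ?G a) = d"
      unfolding x(2) incident_edges_quotient[OF q x(1)] by (simp add: card_image)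
  qed
  show "proper_edge_coloring ?G d quotient_color"
    unfolding proper_edge_coloring_def
  proof (intro conjI ballI impI)
    show "quotient_color ` edges ?G \<subseteq> {1..d}"
      using color_in_range by (auto simp: quotient_graph_def)
    fix m n assume m: "m \<in> edges ?G" and n: "n \<in> edges ?G"
      and mn: "m \<noteq> n \<and> ends ?G m \<inter> ends ?G n \<noteq> {}"
    obtain a where a: "a \<in> ends ?G m" "a \<in> ends ?G n" using mn by blast
    obtain e where e: "e \<in> edges T" "m = quotient_edge q e"
      using m by (auto simp: quotient_graph_def)
    then obtain x where "x \<in> ends T e" "a = q x"
      using a(1) ends_quotient_edge[OF e(1), of q] by auto
    then have x: "x \<in> verts T" "a = q x"
      using ends_in_verts[OF e(1)] by auto
    have "m \<in> incident_edges ?G (q x)" "n \<in> incident_edges ?G (q x)"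
      using m n a x by (auto simp: incident_edges_def)
    then obtain i j where "i \<in> {1..d}" "m = quotient_edge q (edge_at x i)"
      "j \<in> {1..d}" "n = quotient_edge q (edge_at x j)"
      unfolding incident_edges_quotient[OF q x(1)] by blast
    then show "quotient_color m \<noteq> quotient_color n"
      using mn edge_at(2)[OF x(1)] by auto
  qed
  show "1 \<le> d" by (rule degree_pos)
qed

lemma finite_mgraph_quotient:
  assumes "periodic q" and "loopless q"
  shows "finite_mgraph (quotient_graph q)"
proof -
  let ?G = "quotient_graph q"
  interpret G: colored_graph ?G d quotient_color by (rule colored_graph_quotient[OF assms])
  have fin: "finite (verts ?G)" using assms(1) by (simp add: periodic_def quotient_graph_def)
  have "edges ?G \<subseteq> (\<Union>a\<in>verts ?G. incident_edges ?G a)"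
  proof
    fix n assume n: "n \<in> edges ?G"
    then obtain a where "a \<in> verts ?G" "n = G.edge_at a (quotient_color n)" "quotient_color n \<in> {1..d}"
      by (rule G.edge_cases)
    then show "n \<in> (\<Union>a\<in>verts ?G. incident_edges ?G a)"
      using G.edge_at n unfolding incident_edges_def by (metis (mono_tags, lifting) UN_iff mem_Collect_eq)
  qed
  moreover have "finite (incident_edges ?G a)" if "a \<in> verts ?G" for a
    using G.coloring_bij_betw[OF that] bij_betw_finite by blast
  ultimately have "finite (edges ?G)" using fin finite_subset by blast
  then show ?thesis using fin G.mgraph by (simp add: finite_mgraph_def)
qed

lemma is_colored_covering_quotient:
  assumes q: "periodic q" and no_loops: "loopless q"
  shows "is_colored_covering (quotient_graph q) (q v) quotient_color
    (restrict q (verts T), restrict (quotient_edge q) (edges T))" (is "is_colored_covering ?G _ _ ?p")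
proof -
  interpret G: colored_graph ?G d quotient_color by (rule colored_graph_quotient[OF assms])
  have "ends ?G (quotient_edge q e) = restrict q (verts T) ` ends T e" if e: "e \<in> edges T" for e
  proof -
    have "restrict q (verts T) ` ends T e = q ` ends T e"
      by (rule image_cong) (use ends_in_verts e in auto)
    then show ?thesis using ends_quotient_edge e by simp
  qed
  then have "?p \<in> graph_hom T ?G"
    by (auto simp: graph_hom_def quotient_graph_def)
  moreover have "bij_betw (restrict (quotient_edge q) (edges T)) (incident_edges T x) (incident_edges ?G (q x))"
    if x: "x \<in> verts T" for x
  proof -
    have "incident_edges ?G (q x) = quotient_edge q ` incident_edges T x"
      unfolding incident_edges_quotient[OF q x] bij_betw_imp_surj_on[OF edge_at_bij_betw[OF x], symmetric]
      by (simp add: image_image)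
    moreover have "inj_on (quotient_edge q) (incident_edges T x)"
      using coloring_bij_betw[OF x] unfolding bij_betw_def inj_on_def
      by (metis quotient_color_edge)
    ultimately have "bij_betw (quotient_edge q) (incident_edges T x) (incident_edges ?G (q x))"
      by (simp add: bij_betw_def)
    then show ?thesis
      using bij_betw_cong[of "incident_edges T x" "quotient_edge q" "restrict (quotient_edge q) (edges T)"]
      by (simp add: incident_edges_def)
  qed
  ultimately show ?thesis
    by (simp add: is_colored_covering_def covering_maps_def quotient_graph_def)
qed

lemma connected_quotient:
  assumes q: "periodic q"
  shows "connected_mgraph (quotient_graph q)"
proof -
  let ?G = "quotient_graph q"
  have "(adjacent ?G)\<^sup>*\<^sup>* (q x) (q y)" if x: "x \<in> verts T" and y: "y \<in> verts T" for x y
    using x y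
  proof (induction rule: tree_induct)
    case (step y i)
    have "adjacent ?G (q y) (q (nbr y i))"
      unfolding adjacent_def
      using ends_quotient_edge[OF edge_at(1)[OF step(1,2)], of q] edge_at(1)[OF step(1,2)]
        ends_edge_at(1)[OF step(1,2)]
      by (intro bexI[of _ "quotient_edge q (edge_at y i)"]) (simp_all add: quotient_graph_def)
    with step(3) show ?case by (rule rtranclp.rtrancl_into_rtrancl)
  qed simp
  moreover have "verts ?G = q ` verts T" by (simp add: quotient_graph_def)
  moreover have "verts T \<noteq> {}" using base_vertex by blast
  ultimately show ?thesis by (simp add: connected_mgraph_def)
qed

abbreviation "kempe_group \<equiv> generate A (edge_kempe_switches T d \<tau> v)"

definition saturated :: "('a \<Rightarrow> 'q) \<Rightarrow> 'a set \<Rightarrow> bool" where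
  "saturated q Z \<longleftrightarrow> Z \<subseteq> verts T \<and> (\<forall>x\<in>Z. \<forall>y\<in>verts T. q x = q y \<longrightarrow> y \<in> Z)"

lemma saturatedD: "saturated q Z \<Longrightarrow> x \<in> Z \<Longrightarrow> y \<in> verts T \<Longrightarrow> q x = q y \<Longrightarrow> y \<in> Z"
  by (auto simp: saturated_def)

definition chain_closed :: "nat \<Rightarrow> nat \<Rightarrow> 'a set \<Rightarrow> bool" where
  "chain_closed i j Z \<longleftrightarrow> (\<forall>x\<in>Z. nbr x i \<in> Z \<and> nbr x j \<in> Z)"

text \<open>
  The set \<open>Z\<close> is the preimage in the tree of the bichromatic cycle through \<open>q z\<close> in the finite
  quotient by \<open>q\<close>; the minimality of \<open>Z\<close> expresses that this cycle is connected.
\<close>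

lemma kempe_switch_exists:
  assumes q: "periodic (q :: 'a \<Rightarrow> nat)"
    and no_loops: "loopless q"
    and z: "z \<in> verts T" and ij: "i \<in> {1..d}" "j \<in> {1..d}" "i \<noteq> j"
  obtains Z k where "saturated q Z" "z \<in> Z"
    "chain_closed i j Z"
    "\<And>W. saturated q W \<Longrightarrow> z \<in> W \<Longrightarrow> chain_closed i j W \<Longrightarrow> Z \<subseteq> W"
    "k \<in> edge_kempe_switches T d \<tau> v" "k \<in> carrier A" "fst k v = v"
    "\<And>x l. x \<in> verts T \<Longrightarrow> l \<in> {1..d} \<Longrightarrow>
       portrait k x l = (if x \<in> Z then Transposition.transpose i j l else l)"
proof -
  let ?G = "quotient_graph q"
  let ?p = "(restrict q (verts T), restrict (quotient_edge q) (edges T))"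
  interpret G: colored_graph ?G d quotient_color by (rule colored_graph_quotient[OF q no_loops])
  have p: "is_colored_covering ?G (q v) quotient_color ?p"
    by (rule is_colored_covering_quotient[OF q no_loops])
  have fin: "finite_mgraph ?G"
    by (rule finite_mgraph_quotient[OF q no_loops])
  note conn = connected_quotient[OF q]
  have u: "q v \<in> verts ?G" and z': "q z \<in> verts ?G" using z by (auto simp: quotient_graph_def)
  let ?H = "bichromatic_subgraph ?G quotient_color i j"
  define \<gamma> where "\<gamma> = component_at ?H (q z)"
  have \<gamma>: "\<gamma> \<in> bichromatic_cycles ?G quotient_color i j"
    using z' by (simp add: bichromatic_cycles_eq \<gamma>_def)
  define Z where "Z = {x \<in> verts T. (adjacent ?H)\<^sup>*\<^sup>* (q z) (q x)}"
  define c' where "c' = kempe_switch i j \<gamma> quotient_color"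
  have G': "colored_graph ?G d c'"
    unfolding c'_def by (rule G.colored_graph_kempe_switch[OF \<gamma> ij(1,2)])
  define k where "k = recoloring_aut T \<tau> v ?G (q v) quotient_color c'"
  note k = recoloring_aut_portrait[OF G.colored_graph_axioms G' conn u p, folded k_def]
  have edge: "G.edge_at (q x) l = quotient_edge q (edge_at x l)" if "x \<in> verts T" "l \<in> {1..d}" for x l
    using colored_covering_step(2)[OF G.colored_graph_axioms p that] that edge_at(1)[OF that] by simp
  have nbr: "G.nbr (q x) l = q (nbr x l)" if "x \<in> verts T" "l \<in> {1..d}" for x l
    using colored_covering_step(3)[OF G.colored_graph_axioms p that] that nbr_in_verts[OF that] by simp
  have adj: "adjacent ?H (q x) b \<longleftrightarrow> (\<exists>l\<in>{i, j}. b = q (nbr x l))" if x: "x \<in> verts T" for x b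
  proof
    assume "adjacent ?H (q x) b"
    then obtain n where n: "n \<in> edges ?G" "quotient_color n \<in> {i, j}" "ends ?G n = {q x, b}"
      by (auto simp: adjacent_def bichromatic_subgraph_def)
    let ?l = "quotient_color n"
    have l: "?l \<in> {1..d}" using n ij by auto
    have "n = G.edge_at (q x) ?l" using G.edge_eq_edge_at[OF n(1), of "q x"] n(3) by simp
    then have "{q x, b} = {q x, q (nbr x ?l)}"
      using n(3) G.ends_edge_at(1)[of "q x" ?l] nbr[OF x l] x l by (simp add: quotient_graph_def)
    moreover have "q x \<noteq> b"
    proof -
      have "card (ends ?G n) = 2" using G.mgraph n(1) by (simp add: mgraph_def)
      then show ?thesis unfolding n(3) by auto
    qed
    ultimately have "b = q (nbr x ?l)" by (metis doubleton_eq_iff)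
    with n(2) show "\<exists>l\<in>{i, j}. b = q (nbr x l)" by blast
  next
    assume "\<exists>l\<in>{i, j}. b = q (nbr x l)"
    then obtain l where l: "l \<in> {i, j}" "b = q (nbr x l)" by blast
    have ld: "l \<in> {1..d}" using l(1) ij by auto
    let ?n = "quotient_edge q (edge_at x l)"
    note e = edge_at[OF x ld]
    have "ends ?G ?n = {q x, b}"
      using ends_quotient_edge[OF e(1)] ends_edge_at(1)[OF x ld] l(2) by simp
    moreover have "?n \<in> edges ?H" "ends ?H ?n = ends ?G ?n"
      using e l(1) by (auto simp: bichromatic_subgraph_def quotient_graph_def)
    ultimately show "adjacent ?H (q x) b" unfolding adjacent_def by auto
  qed
  show thesis
  proof (rule that[of Z k])
    show "saturated q Z" by (auto simp: saturated_def Z_def)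
    show "z \<in> Z" using z by (simp add: Z_def)
    have "nbr x l \<in> Z" if x: "x \<in> Z" and l: "l \<in> {i, j}" for x l
    proof -
      have xV: "x \<in> verts T" "(adjacent ?H)\<^sup>*\<^sup>* (q z) (q x)" using x by (auto simp: Z_def)
      have "adjacent ?H (q x) (q (nbr x l))" using adj[OF xV(1)] l by blast
      with xV(2) have "(adjacent ?H)\<^sup>*\<^sup>* (q z) (q (nbr x l))" by (rule rtranclp.rtrancl_into_rtrancl)
      moreover have "l \<in> {1..d}" using l ij by auto
      ultimately show ?thesis using nbr_in_verts[OF xV(1)] by (simp add: Z_def)
    qed
    then show "chain_closed i j Z" by (simp add: chain_closed_def)
    show "Z \<subseteq> W" if W: "saturated q W" "z \<in> W" "chain_closed i j W" for W
    proof
      fix x assume x: "x \<in> Z"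
      have "\<exists>y\<in>W. b = q y" if "(adjacent ?H)\<^sup>*\<^sup>* (q z) b" for b
        using that
      proof (induction rule: rtranclp_induct)
        case base
        then show ?case using W(2) by blast
      next
        case (step a b)
        then obtain y where y: "y \<in> W" "a = q y" by blast
        then have "y \<in> verts T" using W(1) by (auto simp: saturated_def)
        then obtain l where "l \<in> {i, j}" "b = q (nbr y l)" using adj step(2) y(2) by blast
        then show ?case using W(3) y(1) unfolding chain_closed_def by blast
      qed
      then obtain y where "y \<in> W" "q x = q y" using x by (auto simp: Z_def)
      then show "x \<in> W" using saturatedD[OF W(1)] x by (auto simp: Z_def)
    qed
    show "k \<in> edge_kempe_switches T d \<tau> v"
      unfolding edge_kempe_switches_def k_def c'_def
      using fin conn G.regular u G.proper ij \<gamma> by blast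
    show "k \<in> carrier A" "fst k v = v" by (rule k)+
    show "portrait k x l = (if x \<in> Z then Transposition.transpose i j l else l)"
      if x: "x \<in> verts T" and l: "l \<in> {1..d}" for x l
    proof -
      have n: "quotient_edge q (edge_at x l) \<in> edges ?G" "q x \<in> ends ?G (quotient_edge q (edge_at x l))"
        using edge_at[OF x l] ends_quotient_edge by (auto simp: quotient_graph_def)
      have "portrait k x l = c' (quotient_edge q (edge_at x l))"
        using k(3)[OF x l] edge[OF x l] x by simp
      also have "\<dots> = (if (adjacent ?H)\<^sup>*\<^sup>* (q z) (q x) then Transposition.transpose i j l else l)"
        unfolding c'_def \<gamma>_def
        using kempe_switch_at[OF G.mgraph z' n] edge_at(2)[OF x l] by simp
      finally show ?thesis using x by (simp add: Z_def)
    qed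
  qed
qed

text \<open>
  A periodic set closed under the chains of colors \<open>i, j\<close> of the coloring \<open>\<tau> \<circ> g\<close> consists of the
  preimages of finitely many bichromatic cycles.  They are switched one after the other.  After
  each switch the periodic map is transported to the new coloring, whose chains of colors \<open>i, j\<close>
  are the same paths.
\<close>

lemma kempe_group_switch_loopless:
  assumes q: "periodic (q :: 'a \<Rightarrow> nat)"
    and no_loops: "loopless q"
    and ij: "i \<in> {1..d}" "j \<in> {1..d}" "i \<noteq> j"
    and h: "h \<in> carrier A" "fst h v = v"
    and "g \<in> kempe_group" "g \<in> carrier A" "fst g v = v" "depends_on q (portrait g)" "saturated q Z"
    and "\<And>x l. x \<in> Z \<Longrightarrow> l \<in> {1..d} \<Longrightarrow> portrait g x l \<in> {i, j} \<Longrightarrow> nbr x l \<in> Z"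
    and "\<And>x. x \<in> verts T \<Longrightarrow>
      portrait h x = (if x \<in> Z then Transposition.transpose i j \<circ> portrait g x else portrait g x)"
  shows "h \<in> kempe_group"
  using assms(8-)
proof (induction "card (q ` Z)" arbitrary: g Z rule: less_induct)
  case less
  note gK = less.prems(1) and g = less.prems(2) and gv = less.prems(3) and dep = less.prems(4)
    and sat = less.prems(5) and closed = less.prems(6) and portrait_h = less.prems(7)
  show ?case
  proof (cases "Z = {}")
    case True
    then have "h = g"
      using portrait_h h g gv by (intro aut_eqI[of _ _ v]) auto
    then show ?thesis using gK by simp
  next
    case False
    then obtain z where z: "z \<in> Z" by blast
    have ZV: "Z \<subseteq> verts T" using sat by (simp add: saturated_def)
    let ?g' = "inv\<^bsub>A\<^esub> g"
    let ?q1 = "\<lambda>y. q (fst ?g' y)"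
    note gD = is_portraitD[OF is_portrait_portrait[OF g]]
    have g': "?g' \<in> carrier A" using g by simp
    have nbr_g: "nbr (fst g x) l = fst g (nbr x (inv_into UNIV (portrait g x) l))"
      if "x \<in> verts T" "l \<in> {1..d}" for x l
      using fst_nbr[OF g that(1) gD(4)[OF that]] gD(5)[OF that(1)] by simp
    have q1: "periodic ?q1" by (rule periodic_translate(1)[OF g q dep])
    have q1_no_loops: "loopless ?q1"
      unfolding loopless_def
    proof (intro ballI)
      fix y l assume that: "y \<in> verts T" "l \<in> {1..d}"
      show "?q1 (nbr y l) \<noteq> ?q1 y"
        using no_loops fst_nbr[OF g' that] aut_fst_in[OF g' that(1)] portrait_in_range[OF g' that]
        by (simp add: loopless_def)
    qed
    have q1_g: "?q1 (fst g x) = q x" if "x \<in> verts T" for x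
      using fst_inv_fst[OF g that] by simp
    have gz: "fst g z \<in> verts T" using z ZV g by blast
    obtain Z1 k where Z1: "saturated ?q1 Z1" "fst g z \<in> Z1"
        "chain_closed i j Z1"
        "\<And>W. saturated ?q1 W \<Longrightarrow> fst g z \<in> W \<Longrightarrow> chain_closed i j W \<Longrightarrow> Z1 \<subseteq> W"
      and k: "k \<in> edge_kempe_switches T d \<tau> v" "k \<in> carrier A" "fst k v = v"
        "\<And>x l. x \<in> verts T \<Longrightarrow> l \<in> {1..d} \<Longrightarrow>
          portrait k x l = (if x \<in> Z1 then Transposition.transpose i j l else l)"
      by (rule kempe_switch_exists[OF q1 q1_no_loops gz ij]) blast
    have Z1_sub: "Z1 \<subseteq> fst g ` Z"
    proof (rule Z1(4))
      show "saturated ?q1 (fst g ` Z)"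
        unfolding saturated_def
      proof (intro conjI ballI impI)
        show "fst g ` Z \<subseteq> verts T" using ZV g by auto
        fix y y' assume y: "y \<in> fst g ` Z" and y': "y' \<in> verts T" and eq: "?q1 y = ?q1 y'"
        obtain x where x: "x \<in> Z" "y = fst g x" using y by blast
        have "q x = q (fst ?g' y')" using eq q1_g x ZV by auto
        then have "fst ?g' y' \<in> Z" using saturatedD[OF sat x(1)] aut_fst_in[OF g' y'] by simp
        then show "y' \<in> fst g ` Z" using fst_fst_inv[OF g y'] by (metis imageI)
      qed
      show "fst g z \<in> fst g ` Z" using z by blast
      have "nbr y l \<in> fst g ` Z" if y: "y \<in> fst g ` Z" and l: "l \<in> {i, j}" for y l
      proof -
        obtain x where x: "x \<in> Z" "y = fst g x" using y by blast
        have xV: "x \<in> verts T" and ld: "l \<in> {1..d}" using x ZV l ij by auto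
        have "nbr x (inv_into UNIV (portrait g x) l) \<in> Z"
          using closed[OF x(1) gD(4)[OF xV ld]] gD(5)[OF xV] l by simp
        then show ?thesis using nbr_g[OF xV ld] x(2) by simp
      qed
      then show "chain_closed i j (fst g ` Z)" by (simp add: chain_closed_def)
    qed
    define Z0 where "Z0 = {x \<in> verts T. fst g x \<in> Z1}"
    have Z0_sub: "Z0 \<subseteq> Z"
    proof
      fix x assume "x \<in> Z0"
      then obtain y where y: "x \<in> verts T" "y \<in> Z" "fst g x = fst g y"
        using Z1_sub by (auto simp: Z0_def)
      then show "x \<in> Z" using ZV fst_inv_fst[OF g] by (metis subsetD)
    qed
    have z0: "z \<in> Z0" using z ZV Z1(2) by (auto simp: Z0_def)
    have sat0: "y \<in> Z0" if "x \<in> Z0" "y \<in> verts T" "q x = q y" for x y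
      using saturatedD[OF Z1(1), of "fst g x" "fst g y"] q1_g that g by (simp add: Z0_def)
    define h1 where "h1 = k \<otimes>\<^bsub>A\<^esub> g"
    have h1: "h1 \<in> carrier A" "fst h1 v = v"
      using g k gv by (simp_all add: h1_def fst_mult)
    have h1K: "h1 \<in> kempe_group"
      unfolding h1_def using gK k(1) by (intro generate.eng) (auto intro: generate.incl)
    have portrait_h1: "portrait h1 x = (if x \<in> Z0 then Transposition.transpose i j \<circ> portrait g x else portrait g x)"
      if x: "x \<in> verts T" for x
    proof
      fix l
      show "portrait h1 x l = (if x \<in> Z0 then Transposition.transpose i j \<circ> portrait g x else portrait g x) l"
      proof (cases "l \<in> {1..d}")
        case True
        then show ?thesis
          using portrait_mult[OF k(2) g x] k(4)[OF aut_fst_in[OF g x] portrait_in_range[OF g x True]] x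
          by (simp add: h1_def Z0_def)
      next
        case False
        moreover have "l \<noteq> i" "l \<noteq> j" using False ij by auto
        ultimately show ?thesis
          using portrait_outside[OF False, of h1 x] portrait_outside[OF False, of g x] by simp
      qed
    qed
    show ?thesis
    proof (rule less.hyps[of "Z - Z0" h1])
      show "card (q ` (Z - Z0)) < card (q ` Z)"
      proof (rule psubset_card_mono)
        show "finite (q ` Z)"
          using q ZV unfolding periodic_def by (meson finite_subset image_mono)
        have "q z \<notin> q ` (Z - Z0)" using sat0[OF z0] ZV by auto
        then show "q ` (Z - Z0) \<subset> q ` Z" using z by blast
      qed
      show "h1 \<in> kempe_group" "h1 \<in> carrier A" "fst h1 v = v" by fact+
      show "depends_on q (portrait h1)"
        unfolding depends_on_def
      proof (intro ballI impI)
        fix x y assume xy: "x \<in> verts T" "y \<in> verts T" "q x = q y"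
        have "x \<in> Z0 \<longleftrightarrow> y \<in> Z0" using sat0 xy by metis
        then show "portrait h1 x = portrait h1 y"
          using portrait_h1 xy depends_onD[OF dep xy] by simp
      qed
      show "saturated q (Z - Z0)"
        unfolding saturated_def
      proof (intro conjI ballI impI)
        show "Z - Z0 \<subseteq> verts T" using ZV by blast
        fix x y assume x: "x \<in> Z - Z0" and y: "y \<in> verts T" and eq: "q x = q y"
        have "y \<in> Z" using saturatedD[OF sat _ y eq] x by blast
        moreover have "y \<notin> Z0" using sat0[OF _ _ eq[symmetric]] x ZV by blast
        ultimately show "y \<in> Z - Z0" by blast
      qed
      show "nbr x l \<in> Z - Z0" if x: "x \<in> Z - Z0" and l: "l \<in> {1..d}" and m: "portrait h1 x l \<in> {i, j}" for x l
      proof -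
        have xV: "x \<in> verts T" using x ZV by blast
        have m: "portrait g x l \<in> {i, j}" using m portrait_h1[OF xV] x by simp
        have "nbr x l \<in> Z" using closed[OF _ l m] x by blast
        moreover have "nbr x l \<notin> Z0"
        proof
          assume "nbr x l \<in> Z0"
          then have "nbr (fst g x) (portrait g x l) \<in> Z1"
            using fst_nbr[OF g xV l] by (simp add: Z0_def)
          then have "nbr (nbr (fst g x) (portrait g x l)) (portrait g x l) \<in> Z1"
            using Z1(3) m unfolding chain_closed_def by blast
          then have "fst g x \<in> Z1"
            using nbr_nbr[OF aut_fst_in[OF g xV] portrait_in_range[OF g xV l]] by simp
          then show False using x xV by (simp add: Z0_def)
        qed
        ultimately show ?thesis by blast
      qed
      show "portrait h x = (if x \<in> Z - Z0 then Transposition.transpose i j \<circ> portrait h1 x else portrait h1 x)"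
        if "x \<in> verts T" for x
        using portrait_h[OF that] portrait_h1[OF that] Z0_sub by auto
    qed
  qed
qed

text \<open>
  By \<open>aut_eqI\<close> and \<open>aut_exists\<close> the quantifier ranges over exactly one automorphism \<open>g\<close>.
\<close>

definition kempe_generated :: "('a \<Rightarrow> 'q) \<Rightarrow> ('a \<Rightarrow> nat \<Rightarrow> nat) \<Rightarrow> bool" where
  "kempe_generated q \<sigma> \<longleftrightarrow> is_portrait \<sigma> \<and> depends_on q \<sigma> \<and>
     (\<forall>g\<in>carrier A. fst g v = v \<and> (\<forall>x\<in>verts T. portrait g x = \<sigma> x) \<longrightarrow> g \<in> kempe_group)"

lemma aut_exists_fixing_base:
  assumes \<sigma>: "is_portrait \<sigma>"
  obtains g where "g \<in> carrier A" "fst g v = v" "\<And>x. x \<in> verts T \<Longrightarrow> portrait g x = \<sigma> x"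
proof -
  obtain g where g: "g \<in> carrier A" "fst g v = v"
    "\<And>x i. x \<in> verts T \<Longrightarrow> i \<in> {1..d} \<Longrightarrow> portrait g x i = \<sigma> x i"
    using aut_exists[OF \<sigma> base_vertex base_vertex] by blast
  have "portrait g x = \<sigma> x" if "x \<in> verts T" for x
  proof
    fix i
    show "portrait g x i = \<sigma> x i"
    proof (cases "i \<in> {1..d}")
      case False
      then show ?thesis
        using permutes_not_in[OF is_portraitD(1)[OF \<sigma> that] False]
        by (simp only: portrait_def if_False)
    qed (use g(3) that in blast)
  qed
  with g that show ?thesis by blast
qed

lemma kempe_generated_id: "kempe_generated q (\<lambda>_. id)"
proof -
  have "g = \<one>\<^bsub>A\<^esub>" if "g \<in> carrier A" "fst g v = v" "\<forall>x\<in>verts T. portrait g x = id" for g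
    using that by (intro aut_eqI[of _ _ v]) (simp_all add: fst_one portrait_one)
  moreover have "\<one>\<^bsub>A\<^esub> \<in> kempe_group" by (rule generate.one)
  ultimately have "\<forall>g\<in>carrier A. fst g v = v \<and> (\<forall>x\<in>verts T. portrait g x = id) \<longrightarrow> g \<in> kempe_group"
    by metis
  then show ?thesis
    by (simp add: kempe_generated_def is_portrait_def depends_on_def permutes_id)
qed

lemma parity_exists:
  obtains par :: "'a \<Rightarrow> bool"
  where "\<And>x i. x \<in> verts T \<Longrightarrow> i \<in> {1..d} \<Longrightarrow> par (nbr x i) = (\<not> par x)"
proof (rule equivariant_map_exists[of "UNIV :: bool set" "\<lambda>b i. \<not> b" v True])
  fix f :: "'a \<Rightarrow> bool"
  assume "\<And>x i. x \<in> verts T \<Longrightarrow> i \<in> {1..d} \<Longrightarrow> f (nbr x i) = (\<not> f x)"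
  then show thesis by (rule that)
qed simp_all

text \<open>
  Pairing the periodic map with the parity of the distance to the base vertex makes the finite
  quotient loopless.
\<close>

lemma kempe_generated_switch:
  fixes q :: "'a \<Rightarrow> 'q"
  assumes q: "periodic q" and \<sigma>: "kempe_generated q \<sigma>"
    and ij: "i \<in> {1..d}" "j \<in> {1..d}" "i \<noteq> j"
    and Z: "saturated q Z"
    and closed: "\<And>x l. x \<in> Z \<Longrightarrow> l \<in> {1..d} \<Longrightarrow> \<sigma> x l \<in> {i, j} \<Longrightarrow> nbr x l \<in> Z"
    and \<sigma>': "\<And>x. x \<in> verts T \<Longrightarrow>
      \<sigma>' x = (if x \<in> Z then Transposition.transpose i j \<circ> \<sigma> x else \<sigma> x)"
  shows "kempe_generated q \<sigma>'"
proof -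
  have port: "is_portrait \<sigma>" and dep: "depends_on q \<sigma>"
    and gen: "\<And>g. g \<in> carrier A \<Longrightarrow> fst g v = v \<Longrightarrow> (\<forall>x\<in>verts T. portrait g x = \<sigma> x) \<Longrightarrow> g \<in> kempe_group"
    using \<sigma> by (auto simp: kempe_generated_def)
  note \<sigma>D = is_portraitD[OF port]
  obtain par :: "'a \<Rightarrow> bool" where par: "\<And>x i. x \<in> verts T \<Longrightarrow> i \<in> {1..d} \<Longrightarrow> par (nbr x i) = (\<not> par x)"
    by (rule parity_exists) blast
  have fin: "finite ((\<lambda>x. (q x, par x)) ` verts T)"
  proof (rule finite_subset)
    show "finite (q ` verts T \<times> (UNIV :: bool set))"
      using q unfolding periodic_def by (intro finite_cartesian_product) simp_all
  qed blast
  obtain enc :: "'q \<times> bool \<Rightarrow> nat" where enc: "inj_on enc ((\<lambda>x. (q x, par x)) ` verts T)"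
    using finite_imp_inj_to_nat_seg[OF fin] by (elim exE conjE)
  define q' where "q' x = enc (q x, par x)" for x
  have q'_eq: "q' x = q' y \<longleftrightarrow> q x = q y \<and> par x = par y" if "x \<in> verts T" "y \<in> verts T" for x y
    using inj_on_eq_iff[OF enc, of "(q x, par x)" "(q y, par y)"] that by (simp add: q'_def)
  have "q' ` verts T = enc ` (\<lambda>x. (q x, par x)) ` verts T"
    by (simp add: q'_def image_image)
  then have "finite (q' ` verts T)" using fin by simp
  then have q': "periodic q'"
    unfolding periodic_def
  proof (intro conjI ballI impI)
    fix x y l assume xy: "x \<in> verts T" "y \<in> verts T" and l: "l \<in> {1..d}" and eq: "q' x = q' y"
    have eq: "q x = q y" "par x = par y" using eq q'_eq[OF xy] by blast+
    show "q' (nbr x l) = q' (nbr y l)"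
      using periodic_nbr[OF q xy l eq(1)] eq(2) par[OF xy(1) l] par[OF xy(2) l]
        q'_eq[OF nbr_in_verts[OF xy(1) l] nbr_in_verts[OF xy(2) l]] by blast
  qed
  have no_loops: "loopless q'"
    unfolding loopless_def using q'_eq[OF nbr_in_verts] par by blast
  have sat: "saturated q' Z"
    using Z q'_eq unfolding saturated_def by (metis subsetD)
  have closed_rev: "x \<in> Z" if "x \<in> verts T" "l \<in> {1..d}" "\<sigma> x l \<in> {i, j}" "nbr x l \<in> Z" for x l
    using closed[OF that(4,2)] \<sigma>D(2)[OF that(1,2)] that by simp
  have "is_portrait \<sigma>'"
    unfolding is_portrait_def
  proof (intro ballI conjI)
    fix x assume x: "x \<in> verts T"
    show "\<sigma>' x permutes {1..d}"
      using \<sigma>'[OF x] \<sigma>D(1)[OF x] permutes_compose[OF \<sigma>D(1)[OF x] permutes_swap_id[OF ij(1,2)]] by simp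
    fix l assume l: "l \<in> {1..d}"
    show "\<sigma>' (nbr x l) l = \<sigma>' x l"
      using \<sigma>'[OF x] \<sigma>'[OF nbr_in_verts[OF x l]] \<sigma>D(2)[OF x l] closed[OF _ l] closed_rev[OF x l]
      by (cases "\<sigma> x l \<in> {i, j}") auto
  qed
  moreover have "depends_on q \<sigma>'"
    unfolding depends_on_def
  proof (intro ballI impI)
    fix x y assume xy: "x \<in> verts T" "y \<in> verts T" "q x = q y"
    have "x \<in> Z \<longleftrightarrow> y \<in> Z" using saturatedD[OF Z] xy by metis
    then show "\<sigma>' x = \<sigma>' y" using \<sigma>' xy depends_onD[OF dep xy] by simp
  qed
  moreover have "h \<in> kempe_group"
    if h: "h \<in> carrier A" "fst h v = v" and hp: "\<forall>x\<in>verts T. portrait h x = \<sigma>' x" for h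
  proof -
    obtain g where g: "g \<in> carrier A" "fst g v = v" "\<And>x. x \<in> verts T \<Longrightarrow> portrait g x = \<sigma> x"
      by (rule aut_exists_fixing_base[OF port]) blast
    have ZV: "x \<in> verts T" if "x \<in> Z" for x using Z that by (auto simp: saturated_def)
    have dep_g: "depends_on q' (portrait g)"
      unfolding depends_on_def using g(3) q'_eq depends_onD[OF dep] by metis
    show ?thesis
    proof (rule kempe_group_switch_loopless[OF q' no_loops ij h _ g(1,2) dep_g sat])
      show "g \<in> kempe_group" using gen[OF g(1,2)] g(3) by blast
      show "nbr x l \<in> Z" if "x \<in> Z" "l \<in> {1..d}" "portrait g x l \<in> {i, j}" for x l
        using closed[OF that(1,2)] that(3) g(3)[OF ZV[OF that(1)]] by simp
      show "portrait h x = (if x \<in> Z then Transposition.transpose i j \<circ> portrait g x else portrait g x)"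
        if "x \<in> verts T" for x
        using hp that \<sigma>'[OF that] g(3)[OF that] by simp
    qed
  qed
  ultimately show ?thesis unfolding kempe_generated_def by blast
qed

end

section \<open>Moving one color class\<close>

context colored_tree
begin

lemma kempe_generated_cong:
  assumes "kempe_generated q \<sigma>" and eq: "\<And>x. x \<in> verts T \<Longrightarrow> \<sigma>' x = \<sigma> x"
  shows "kempe_generated q \<sigma>'"
proof -
  have "is_portrait \<sigma>'"
    using assms(1) eq nbr_in_verts by (simp add: kempe_generated_def is_portrait_def)
  moreover have "depends_on q \<sigma>'"
    using assms(1) eq unfolding kempe_generated_def depends_on_def by metis
  ultimately show ?thesis
    using assms(1) eq unfolding kempe_generated_def by metis
qed

text \<open>
  Only edges of color \<open>k\<close> join different level sets of \<open>\<rho>\<close>, so each level set is closed under the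
  chains of any two colors below \<open>k\<close> and its colors can be permuted by transpositions.
\<close>

lemma kempe_generated_sheets:
  assumes q: "periodic q" and dep: "depends_on q \<rho>" and k: "k \<in> {1..d}"
    and perm: "\<And>x. x \<in> verts T \<Longrightarrow> \<rho> x permutes {1..<k}"
    and const: "\<And>x i. x \<in> verts T \<Longrightarrow> i \<in> {1..d} \<Longrightarrow> i \<noteq> k \<Longrightarrow> \<rho> (nbr x i) = \<rho> x"
  shows "kempe_generated q \<rho>"
proof -
  have "finite (\<rho> ` verts T)"
    by (rule finite_subset[OF _ finite_permutations[of "{1..<k}"]]) (use perm in auto)
  moreover have "kempe_generated q (\<lambda>x. if \<rho> x \<in> F then \<rho> x else id)"
    if "finite F" "F \<subseteq> \<rho> ` verts T" for F
    using that
  proof (induction rule: finite_subset_induct')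
    case empty
    show ?case by (rule kempe_generated_cong[OF kempe_generated_id]) (simp add: id_def)
  next
    case (insert p F)
    then have p: "p permutes {1..<k}" using perm by blast
    have "kempe_generated q (\<lambda>x. if \<rho> x \<in> F then \<rho> x else if \<rho> x = p then p' else id)"
      if "p' permutes {1..<k}" for p'
      using that finite_atLeastLessThan
    proof (induction rule: permutes_induct)
      case id
      show ?case by (rule kempe_generated_cong[OF insert.IH]) simp
    next
      case (swap a b p')
      have ab: "a \<in> {1..d}" "b \<in> {1..d}" using swap.hyps(1,2) k by auto
      show ?case
      proof (rule kempe_generated_switch[OF q swap.IH ab swap.hyps(3)])
        let ?Z = "{x \<in> verts T. \<rho> x = p}"
        show "saturated q ?Z"
          unfolding saturated_def
        proof (intro conjI ballI impI)
          fix x y assume x: "x \<in> ?Z" and y: "y \<in> verts T" and eq: "q x = q y"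
          show "y \<in> ?Z" using depends_onD[OF dep _ y eq] x y by simp
        qed blast
        show "nbr x l \<in> ?Z"
          if x: "x \<in> ?Z" and l: "l \<in> {1..d}"
            and m: "(if \<rho> x \<in> F then \<rho> x else if \<rho> x = p then p' else id) l \<in> {a, b}" for x l
        proof -
          have "p' l \<in> {a, b}" using m x insert.hyps by auto
          then have "p' l \<in> {1..<k}" using swap.hyps(1,2) by blast
          then have "l \<noteq> k"
            using permutes_in_image[OF swap.hyps(4), of l] by auto
          then show ?thesis using const x l by auto
        qed
        show "(if \<rho> x \<in> F then \<rho> x else if \<rho> x = p then Transposition.transpose a b \<circ> p' else id)
          = (if x \<in> ?Z then Transposition.transpose a b \<circ>
               (if \<rho> x \<in> F then \<rho> x else if \<rho> x = p then p' else id)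
             else if \<rho> x \<in> F then \<rho> x else if \<rho> x = p then p' else id)"
          if "x \<in> verts T" for x
          using that insert.hyps by auto
      qed
    qed
    from this[OF p] show ?case
      by (rule kempe_generated_cong) auto
  qed
  ultimately have "kempe_generated q (\<lambda>x. if \<rho> x \<in> \<rho> ` verts T then \<rho> x else id)"
    by blast
  then show ?thesis
    by (rule kempe_generated_cong) simp
qed

text \<open>
  Let \<open>M\<close> be the set of edges that \<open>g\<close> maps to edges of color \<open>k\<close>, and \<open>j x\<close> the color of the edge
  of \<open>M\<close> at \<open>x\<close>.  The permutation \<open>\<rho>\<close> is carried along all edges unchanged, except that crossing an
  edge of color \<open>k\<close> composes it with the transposition of the values of \<open>j\<close> at its two ends.
  After permuting the colors below \<open>k\<close> by \<open>\<rho>\<close>, the edges of \<open>M\<close> on a path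
  alternating between \<open>M\<close> and color \<open>k\<close> all have the same color \<open>a\<close>.  So this path is a chain of
  colors \<open>a, k\<close>, and switching it gives its edges in \<open>M\<close> the color \<open>k\<close>.
\<close>

lemma kempe_step:
  assumes g: "g \<in> carrier A" and q0: "periodic q\<^sub>0" and dep: "depends_on q\<^sub>0 (portrait g)"
    and k: "k \<in> {1..d}"
    and fixed: "\<And>x i. x \<in> verts T \<Longrightarrow> i \<in> {k<..d} \<Longrightarrow> portrait g x i = i"
  obtains g\<^sub>1 where "g\<^sub>1 \<in> kempe_group" "g\<^sub>1 \<in> carrier A" "fst g\<^sub>1 v = v"
    "\<And>x i. x \<in> verts T \<Longrightarrow> i \<in> {k..d} \<Longrightarrow> portrait (g \<otimes>\<^bsub>A\<^esub> inv\<^bsub>A\<^esub> g\<^sub>1) x i = i"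
proof -
  note gD = is_portraitD[OF is_portrait_portrait[OF g]]
  define j where "j x = inv_into UNIV (portrait g x) k" for x
  have j: "portrait g x (j x) = k" if "x \<in> verts T" for x
    using gD(5)[OF that] by (simp add: j_def)
  have j_eqI: "j x = i" if "x \<in> verts T" "portrait g x i = k" for x i
    using gD(6)[OF that(1), of i] that(2) by (simp add: j_def)
  have j_range: "j x \<in> {1..k}" if x: "x \<in> verts T" for x
  proof -
    have jd: "j x \<in> {1..d}" using gD(4)[OF x k] by (simp add: j_def)
    have "\<not> k < j x"
    proof
      assume less: "k < j x"
      then have "portrait g x (j x) = j x" using fixed[OF x, of "j x"] jd by simp
      then show False using j[OF x] less by simp
    qed
    then show ?thesis using jd by simp
  qed
  have j_nbr: "j (nbr x i) = i" if "x \<in> verts T" "i \<in> {1..d}" "j x = i" for x i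
    using j_eqI[OF nbr_in_verts[OF that(1,2)]] gD(2)[OF that(1,2)] j[OF that(1)] that(3) by simp
  have j_dep: "j x = j y" if "x \<in> verts T" "y \<in> verts T" "q\<^sub>0 x = q\<^sub>0 y" for x y
    using depends_onD[OF dep that] by (simp add: j_def)
  \<comment> \<open>If the edge of color \<open>k\<close> at \<open>x\<close> is in \<open>M\<close>, both values of \<open>j\<close> are \<open>k\<close>; otherwise both are below \<open>k\<close>.\<close>
  define t where "t x = Transposition.transpose (j x) (j (nbr x k))" for x
  have t_perm: "t x permutes {1..<k}" if x: "x \<in> verts T" for x
  proof (cases "j x = k")
    case True
    then show ?thesis using j_nbr[OF x k] by (simp add: t_def permutes_id)
  next
    case False
    have "j (nbr x k) \<noteq> k"
      using j_nbr[OF nbr_in_verts[OF x k] k] nbr_nbr[OF x k] False by auto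
    then show ?thesis
      unfolding t_def using False j_range[OF x] j_range[OF nbr_in_verts[OF x k]]
      by (intro permutes_swap_id) auto
  qed
  have t_nbr: "t (nbr x k) = t x" if "x \<in> verts T" for x
    using nbr_nbr[OF that k] by (simp add: t_def transpose_commute)
  let ?S = "verts T \<times> {p. p permutes {1..<k}}"
  let ?act = "\<lambda>u i. (nbr (fst u) i, if i = k then snd u \<circ> t (fst u) else snd u)"
  obtain f where f: "f v = (v, id)" "\<And>x. x \<in> verts T \<Longrightarrow> f x \<in> ?S"
    "\<And>x i. x \<in> verts T \<Longrightarrow> i \<in> {1..d} \<Longrightarrow> f (nbr x i) = ?act (f x) i"
  proof (rule equivariant_map_exists[of ?S ?act v "(v, id)"])
    fix u i assume u: "u \<in> ?S" and i: "i \<in> {1..d}"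
    then obtain x p where xp: "u = (x, p)" "x \<in> verts T" "p permutes {1..<k}" by auto
    have "p \<circ> t x permutes {1..<k}"
      using t_perm[OF xp(2)] xp(3) by (rule permutes_compose)
    moreover have "p \<circ> t x \<circ> t x = p" by (simp add: t_def comp_assoc)
    ultimately show "?act u i \<in> ?S \<and> ?act (?act u i) i = u"
      using xp i t_nbr[OF xp(2)] by simp
  qed (use permutes_id in auto)
  define \<rho> where "\<rho> x = snd (f x)" for x
  have f_fst: "fst (f x) = x" if "x \<in> verts T" for x
    using base_vertex that by (induction rule: tree_induct) (simp_all add: f)
  have \<rho>_perm: "\<rho> x permutes {1..<k}" if "x \<in> verts T" for x
    using f(2)[OF that] by (auto simp: \<rho>_def)
  have \<rho>_nbr: "\<rho> (nbr x i) = (if i = k then \<rho> x \<circ> t x else \<rho> x)" if "x \<in> verts T" "i \<in> {1..d}" for x i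
    using f(3)[OF that] f_fst[OF that(1)] by (simp add: \<rho>_def)
  have \<rho>_fixed: "\<rho> x i = i" if "x \<in> verts T" "k \<le> i" for x i
    using permutes_not_in[OF \<rho>_perm[OF that(1)], of i] that(2) by simp
  have \<rho>_inj: "i = i'" if "x \<in> verts T" "\<rho> x i = \<rho> x i'" for x i i'
    using permutes_inj[OF \<rho>_perm[OF that(1)]] that(2) by (rule injD)
  define q where "q x = (q\<^sub>0 x, \<rho> x)" for x
  have q: "periodic q"
    unfolding periodic_def
  proof (intro conjI ballI impI)
    have "finite (q\<^sub>0 ` verts T)" using q0 unfolding periodic_def by (rule conjunct1)
    then have "finite (q\<^sub>0 ` verts T \<times> {p. p permutes {1..<k}})"
      using finite_permutations[of "{1..<k}"] by simp
    moreover have "q ` verts T \<subseteq> q\<^sub>0 ` verts T \<times> {p. p permutes {1..<k}}"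
      using \<rho>_perm by (auto simp: q_def)
    ultimately show "finite (q ` verts T)" by (rule rev_finite_subset)
    fix x y i assume xy: "x \<in> verts T" "y \<in> verts T" and i: "i \<in> {1..d}" and eq: "q x = q y"
    have eq: "q\<^sub>0 x = q\<^sub>0 y" "\<rho> x = \<rho> y" using eq by (simp_all add: q_def)
    have "t x = t y"
      unfolding t_def
      using j_dep[OF xy eq(1)] j_dep[OF nbr_in_verts[OF xy(1) k] nbr_in_verts[OF xy(2) k]]
        periodic_nbr[OF q0 xy k eq(1)] by simp
    then show "q (nbr x i) = q (nbr y i)"
      using periodic_nbr[OF q0 xy i eq(1)] eq(2) \<rho>_nbr[OF xy(1) i] \<rho>_nbr[OF xy(2) i]
      by (simp add: q_def)
  qed
  have \<rho>_gen: "kempe_generated q \<rho>"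
    by (rule kempe_generated_sheets[OF q _ k]) (use \<rho>_perm \<rho>_nbr in \<open>auto simp: depends_on_def q_def\<close>)
  define a where "a x = \<rho> x (j x)" for x
  have a_range: "a x \<in> {1..k}" if x: "x \<in> verts T" for x
  proof (cases "j x = k")
    case True
    then show ?thesis using \<rho>_fixed[OF x] k by (simp add: a_def)
  next
    case False
    then have "\<rho> x (j x) \<in> {1..<k}"
      using permutes_in_image[OF \<rho>_perm[OF x], of "j x"] j_range[OF x] by auto
    then show ?thesis by (simp add: a_def)
  qed
  have a_nbr_k: "a (nbr x k) = a x" if x: "x \<in> verts T" for x
    using \<rho>_nbr[OF x k] by (simp add: a_def t_def)
  have a_nbr: "a (nbr x i) = a x" if x: "x \<in> verts T" "i \<in> {1..d}" "i \<noteq> k" "j x = i" for x i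
    using \<rho>_nbr[OF x(1,2)] j_nbr[OF x(1,2,4)] x(3,4) by (simp add: a_def)
  \<comment> \<open>The portrait in which the alternating paths of color \<open>a x \<le> m\<close> have been switched.  The value
    \<open>a x = k\<close> occurs at edges of \<open>M\<close> that already have color \<open>k\<close>.\<close>
  define \<sigma> where "\<sigma> m x = (if a x \<le> m then Transposition.transpose (a x) k \<circ> \<rho> x else \<rho> x)" for m x
  have gen: "kempe_generated q (\<sigma> m)" if "m < k" for m
    using that
  proof (induction m)
    case 0
    show ?case
      using \<rho>_gen by (rule kempe_generated_cong) (use a_range in \<open>force simp: \<sigma>_def\<close>)
  next
    case (Suc m)
    have m: "Suc m \<in> {1..d}" "Suc m \<noteq> k" using Suc.prems k by auto
    let ?Z = "{x \<in> verts T. a x = Suc m}"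
    have IH: "kempe_generated q (\<sigma> m)" using Suc by simp
    show ?case
    proof (rule kempe_generated_switch[OF q IH m(1) k m(2)])
      show "saturated q ?Z"
        unfolding saturated_def
      proof (intro conjI ballI impI)
        fix x y assume x: "x \<in> ?Z" and y: "y \<in> verts T" and eq: "q x = q y"
        have xV: "x \<in> verts T" and eq: "q\<^sub>0 x = q\<^sub>0 y" "\<rho> x = \<rho> y"
          using x eq by (auto simp: q_def)
        show "y \<in> ?Z" using j_dep[OF xV y eq(1)] eq(2) x y by (simp add: a_def)
      qed blast
      show "nbr x l \<in> ?Z" if x: "x \<in> ?Z" and l: "l \<in> {1..d}" and s: "\<sigma> m x l \<in> {Suc m, k}" for x l
      proof -
        have xV: "x \<in> verts T" and ax: "a x = Suc m" using x by auto
        have "\<rho> x l = k \<or> \<rho> x l = a x" using s ax by (auto simp: \<sigma>_def)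
        then have "a (nbr x l) = a x"
        proof
          assume "\<rho> x l = k"
          then have "l = k" using \<rho>_inj[OF xV, of l k] \<rho>_fixed[OF xV, of k] by simp
          then show ?thesis using a_nbr_k[OF xV] by simp
        next
          assume *: "\<rho> x l = a x"
          then have "j x = l" using \<rho>_inj[OF xV, of "j x" l] by (simp add: a_def)
          moreover have "l \<noteq> k" using * ax m(2) \<rho>_fixed[OF xV, of k] by auto
          ultimately show ?thesis using a_nbr[OF xV l] by blast
        qed
        then show ?thesis using ax nbr_in_verts[OF xV l] by simp
      qed
      show "\<sigma> (Suc m) x = (if x \<in> ?Z then Transposition.transpose (Suc m) k \<circ> \<sigma> m x else \<sigma> m x)"
        if "x \<in> verts T" for x
        using that by (auto simp: \<sigma>_def)
    qed
  qed
  define \<sigma>\<^sub>1 where "\<sigma>\<^sub>1 = \<sigma> (k - 1)"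
  have gen1: "kempe_generated q \<sigma>\<^sub>1" unfolding \<sigma>\<^sub>1_def using gen[of "k - 1"] k by simp
  then have port1: "is_portrait \<sigma>\<^sub>1" by (simp add: kempe_generated_def)
  obtain g\<^sub>1 where g1: "g\<^sub>1 \<in> carrier A" "fst g\<^sub>1 v = v" "\<And>x. x \<in> verts T \<Longrightarrow> portrait g\<^sub>1 x = \<sigma>\<^sub>1 x"
    by (rule aut_exists_fixing_base[OF port1]) blast
  have g1K: "g\<^sub>1 \<in> kempe_group"
    using gen1 g1 unfolding kempe_generated_def by blast
  have \<sigma>1_j: "\<sigma>\<^sub>1 x (j x) = k" if "x \<in> verts T" for x
    using a_range[OF that] by (auto simp: \<sigma>\<^sub>1_def \<sigma>_def a_def[symmetric])
  have \<sigma>1_fixed: "\<sigma>\<^sub>1 x i = i" if "x \<in> verts T" "k < i" for x i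
    using a_range[OF that(1)] \<rho>_fixed[OF that(1), of i] that(2)
    by (auto simp: \<sigma>\<^sub>1_def \<sigma>_def Transposition.transpose_def)
  have "portrait (g \<otimes>\<^bsub>A\<^esub> inv\<^bsub>A\<^esub> g\<^sub>1) y i = i" if y: "y \<in> verts T" and i: "i \<in> {k..d}" for y i
  proof -
    define x where "x = fst (inv\<^bsub>A\<^esub> g\<^sub>1) y"
    have x: "x \<in> verts T" using y g1(1) by (simp add: x_def)
    note D = is_portraitD[OF port1 x]
    have eq: "portrait (g \<otimes>\<^bsub>A\<^esub> inv\<^bsub>A\<^esub> g\<^sub>1) y = portrait g x \<circ> inv_into UNIV (\<sigma>\<^sub>1 x)"
      using portrait_mult[OF g _ y, of "inv\<^bsub>A\<^esub> g\<^sub>1"] portrait_inv_at[OF g1(1) y] g1(1) g1(3)[OF x]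
      by (simp add: x_def)
    show ?thesis
    proof (cases "i = k")
      case True
      have "inv_into UNIV (\<sigma>\<^sub>1 x) k = j x" using D(6)[of "j x"] \<sigma>1_j[OF x] by simp
      then show ?thesis using eq True j[OF x] by simp
    next
      case False
      then have i': "k < i" "i \<in> {k<..d}" using i by auto
      have "inv_into UNIV (\<sigma>\<^sub>1 x) i = i" using D(6)[of i] \<sigma>1_fixed[OF x i'(1)] by simp
      then show ?thesis using eq fixed[OF x i'(2)] by simp
    qed
  qed
  with g1K g1(1,2) show ?thesis by (rule that)
qed

section \<open>Edge Kempe switches generate the stabilizer\<close>

lemma edge_kempe_switch_fixes_base:
  assumes "g \<in> edge_kempe_switches T d \<tau> v"
  shows "g \<in> commensurator A \<Gamma>\<^sub>\<tau>" "fst g v = v"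
proof -
  obtain G :: "(nat, nat) mgraph" and u c i j \<gamma> where
    g: "g = recoloring_aut T \<tau> v G u c (kempe_switch i j \<gamma> c)"
    and G: "finite_mgraph G" "connected_mgraph G" "regular_mgraph d G" "u \<in> verts G"
      "proper_edge_coloring G d c" "i \<in> {1..d}" "j \<in> {1..d}" "\<gamma> \<in> bichromatic_cycles G c i j"
    using assms unfolding edge_kempe_switches_def by blast
  have G1: "colored_graph G d c"
    using G degree_pos by (simp add: colored_graph_def finite_mgraph_def)
  have G2: "colored_graph G d (kempe_switch i j \<gamma> c)"
    by (rule colored_graph.colored_graph_kempe_switch[OF G1 G(8,6,7)])
  obtain p where p: "is_colored_covering G u c p"
    using colored_covering_exists[OF G1 G(2,4)] by blast
  show "fst g v = v"
    unfolding g by (rule recoloring_aut_portrait(2)[OF G1 G2 G(2,4) p])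
  show "g \<in> commensurator A \<Gamma>\<^sub>\<tau>"
    unfolding g using G(1) by (intro recoloring_aut_in_commensurator[OF G1 G2 _ G(2,4)]) (simp add: finite_mgraph_def)
qed

lemma subgroup_commensurator_stabilizer:
  "subgroup {g \<in> commensurator A \<Gamma>\<^sub>\<tau>. fst g v = v} A"
proof -
  note C = A.subgroup_commensurator[OF subgroup_color_preserving]
  note carr = subgroup.mem_carrier[OF C]
  show ?thesis
  proof (rule A.subgroupI)
    show "{g \<in> commensurator A \<Gamma>\<^sub>\<tau>. fst g v = v} \<subseteq> carrier A" using carr by blast
    have "\<one>\<^bsub>A\<^esub> \<in> {g \<in> commensurator A \<Gamma>\<^sub>\<tau>. fst g v = v}"
      using subgroup.one_closed[OF C] by (simp add: fst_one)
    then show "{g \<in> commensurator A \<Gamma>\<^sub>\<tau>. fst g v = v} \<noteq> {}" by blast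
    show "inv\<^bsub>A\<^esub> g \<in> {g \<in> commensurator A \<Gamma>\<^sub>\<tau>. fst g v = v}"
      if "g \<in> {g \<in> commensurator A \<Gamma>\<^sub>\<tau>. fst g v = v}" for g
      using that subgroup.m_inv_closed[OF C] fst_inv_fst[OF carr base_vertex, of g] by simp
    show "g \<otimes>\<^bsub>A\<^esub> h \<in> {g \<in> commensurator A \<Gamma>\<^sub>\<tau>. fst g v = v}"
      if "g \<in> {g \<in> commensurator A \<Gamma>\<^sub>\<tau>. fst g v = v}" "h \<in> {g \<in> commensurator A \<Gamma>\<^sub>\<tau>. fst g v = v}" for g h
      using that subgroup.m_closed[OF C] fst_mult[OF carr carr base_vertex, of g h] by simp
  qed
qed

lemma kempe_group_subset: "kempe_group \<subseteq> {g \<in> commensurator A \<Gamma>\<^sub>\<tau>. fst g v = v}"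
  by (rule A.generate_subgroup_incl[OF _ subgroup_commensurator_stabilizer])
    (use edge_kempe_switch_fixes_base in blast)

text \<open>
  Dividing \<open>g\<close> by an element of the Kempe group fixes one more color; a portrait that fixes all
  colors belongs to the identity.
\<close>

lemma kempe_group_if_fixes_large_colors:
  assumes "g \<in> commensurator A \<Gamma>\<^sub>\<tau>" "fst g v = v" "k \<le> d"
    and "\<And>x i. x \<in> verts T \<Longrightarrow> i \<in> {k<..d} \<Longrightarrow> portrait g x i = i"
  shows "g \<in> kempe_group"
  using assms
proof (induction k arbitrary: g)
  case 0
  have gA: "g \<in> carrier A" using 0(1) by (simp add: A.mem_commensurator)
  have "g = \<one>\<^bsub>A\<^esub>"
    by (rule aut_eqI[OF gA A.one_closed base_vertex])
      (use 0 in \<open>auto simp: fst_one portrait_one\<close>)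
  then show ?case by (simp add: generate.one)
next
  case (Suc k)
  have gA: "g \<in> carrier A" using Suc.prems(1) by (simp add: A.mem_commensurator)
  obtain q :: "'a \<Rightarrow> 'a set" where q: "periodic q" "depends_on q (portrait g)"
    using commensurator_color_preserving_periodic[OF Suc.prems(1)] .
  have k: "Suc k \<in> {1..d}" using Suc.prems(3) by simp
  obtain g\<^sub>1 where g1: "g\<^sub>1 \<in> kempe_group" "g\<^sub>1 \<in> carrier A" "fst g\<^sub>1 v = v"
    "\<And>x i. x \<in> verts T \<Longrightarrow> i \<in> {Suc k..d} \<Longrightarrow> portrait (g \<otimes>\<^bsub>A\<^esub> inv\<^bsub>A\<^esub> g\<^sub>1) x i = i"
    by (rule kempe_step[OF gA q k Suc.prems(4)]) blast+
  let ?g = "g \<otimes>\<^bsub>A\<^esub> inv\<^bsub>A\<^esub> g\<^sub>1"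
  note H = subgroup_commensurator_stabilizer
  have "g \<in> {g \<in> commensurator A \<Gamma>\<^sub>\<tau>. fst g v = v}" "g\<^sub>1 \<in> {g \<in> commensurator A \<Gamma>\<^sub>\<tau>. fst g v = v}"
    using Suc.prems(1,2) kempe_group_subset g1(1) by blast+
  then have "?g \<in> {g \<in> commensurator A \<Gamma>\<^sub>\<tau>. fst g v = v}"
    by (intro subgroup.m_closed[OF H] subgroup.m_inv_closed[OF H])
  then have "?g \<in> kempe_group"
    using Suc.prems(3) g1(4) by (intro Suc.IH) (auto simp: greaterThanAtMost_def)
  then have "?g \<otimes>\<^bsub>A\<^esub> g\<^sub>1 \<in> kempe_group"
    using g1(1) by (rule generate.eng)
  then show ?case
    using gA g1(2) by (simp add: A.m_assoc)
qed

end

theorem corollary1: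
  fixes d :: nat
    and T :: "('a, 'b) mgraph"
    and \<Gamma> :: "('a, 'b, 'a, 'b) gmap set"
    and v :: 'a
    and \<tau> :: "'b \<Rightarrow> nat"
  assumes "d \<ge> 1"
    and "tree T" and "regular_mgraph d T"
    and "uniform_lattice T \<Gamma>"
    and "v \<in> verts T"
    and "proper_edge_coloring T d \<tau>"
    and "commensurable (aut_group T) \<Gamma> (color_preserving T \<tau>)"
  defines "C \<equiv> commensurator (aut_group T) \<Gamma>"
  shows "generate (aut_group T) (edge_kempe_switches T d \<tau> v)
           = stabilizer ((aut_group T)\<lparr>carrier := C\<rparr>) fst v"
proof -
  interpret colored_tree T d \<tau> v
    using assms by unfold_locales (auto simp: tree_def)
  have "C = commensurator A \<Gamma>\<^sub>\<tau>"
    unfolding C_def using assms(4,7) subgroup_color_preserving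
    by (intro A.commensurator_cong) (simp_all add: uniform_lattice_def)
  then have stab: "stabilizer (A\<lparr>carrier := C\<rparr>) fst v = {g \<in> commensurator A \<Gamma>\<^sub>\<tau>. fst g v = v}"
    by (simp add: stabilizer_def)
  have "g \<in> kempe_group" if "g \<in> commensurator A \<Gamma>\<^sub>\<tau>" "fst g v = v" for g
    using that by (rule kempe_group_if_fixes_large_colors[of _ d]) auto
  then show ?thesis
    unfolding stab using kempe_group_subset by blast
qed

end
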